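(* Let $n\ge1$. The Cartesian product of $n$ snowflakes of $\mathbb{R}$ has Lipschitz dimension $n$. In particular, each snowflake of $\mathbb{R}^n$ has Lipschitz dimension $n$.
   Context: Snowflakes: a map $f\colon X\to Y$ of metric spaces is a snowflake map (or $\alpha$-snowflake map) if there are $\alpha\in(0,1]$ and $C>0$ with $C^{-1}d(x,y)^\alpha\le d(f(x),f(y))\le Cd(x,y)^\alpha$ for all $x,y\in X$. A snowflake of $X$ is the image of $X$ under such a map, equivalently a metric space bi-Lipschitz equivalent to $(X,d^\alpha)$ for some $\alpha\in(0,1]$. Different factors of the product may have different exponents. $\mathbb{R}$ and $\mathbb{R}^n$ carry the Euclidean metric. Cartesian products carry the maximum of the metrics of the factors. Lipschitz dimension: for $r>0$, an $r$-path in a metric space $X$ is a finite sequence $(x_1,\dots,x_k)$ in $X$ with $d(x_i,x_{i+1})\le r$ for $1\le i\le k-1$. Two points are in the same $r$-component of $X$ if some $r$-path in $X$ contains both. The $r$-components of a subset are those of the subset as a metric space. A map $f\colon X\to Y$ is Lipschitz light if there is $C>0$ such that $f$ is $C$-Lipschitz and, for every $r>0$ and every $W\subset Y$ with $\mathrm{diam}(W)\le r$, the $r$-components of $f^{-1}(W)$ have diameter at most $Cr$. The Lipschitz dimension $\dim_L(X)$ is the minimal integer $n\ge0$ such that there is a Lipschitz light map $X\to\mathbb{R}^n$ (with $\mathbb{R}^0$ a one-point space), or $\infty$ if there is none. *)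

theory Defs
  imports "HOL-Analysis.Analysis"
begin

section \<open>Metric spaces: diameter, Euclidean space, maximum product\<close>

definition mdiameter :: "'a metric \<Rightarrow> 'a set \<Rightarrow> ennreal" where
  "mdiameter X S = (SUP (x, y) \<in> S \<times> S. ennreal (mdist X x y))"

text \<open>The carrier is that of the library topology \<^const>\<open>Euclidean_space\<close>, i.e. the sequences
  vanishing from index \<open>n\<close> on; the dimension is a term, so that it can be quantified over.\<close>

definition euclidean_n :: "nat \<Rightarrow> (nat \<Rightarrow> real) metric" where
  "euclidean_n n =
     metric (topspace (Euclidean_space n), \<lambda>x y. L2_set (\<lambda>i. x i - y i) {..<n})"

text \<open>Inserting 0 only matters for \<open>n = 0\<close>, where the carrier is a single point.\<close>

definition max_product_metric :: "nat \<Rightarrow> (nat \<Rightarrow> 'a metric) \<Rightarrow> (nat \<Rightarrow> 'a) metric" where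
  "max_product_metric n X =
     metric (\<Pi>\<^sub>E i\<in>{..<n}. mspace (X i),
       \<lambda>x y. Max (insert 0 ((\<lambda>i. mdist (X i) (x i) (y i)) ` {..<n})))"

lemma Metric_space_euclidean_n:
  "Metric_space (topspace (Euclidean_space n)) (\<lambda>x y. L2_set (\<lambda>i. x i - y i) {..<n})"
proof
  fix x y z :: "nat \<Rightarrow> real"
  show "0 \<le> L2_set (\<lambda>i. x i - y i) {..<n}"
    by simp
  show "L2_set (\<lambda>i. x i - y i) {..<n} = L2_set (\<lambda>i. y i - x i) {..<n}"
    by (simp add: L2_set_def power2_commute)
  show "(L2_set (\<lambda>i. x i - y i) {..<n} = 0) = (x = y)"
    if "x \<in> topspace (Euclidean_space n)" "y \<in> topspace (Euclidean_space n)"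
  proof -
    have "x = y" if "\<forall>i<n. x i = y i"
    proof
      fix i show "x i = y i"
        using that \<open>x \<in> _\<close> \<open>y \<in> _\<close> by (cases "i < n") (auto simp: topspace_Euclidean_space)
    qed
    then show ?thesis
      by (auto simp: L2_set_eq_0_iff)
  qed
  show "L2_set (\<lambda>i. x i - z i) {..<n}
      \<le> L2_set (\<lambda>i. x i - y i) {..<n} + L2_set (\<lambda>i. y i - z i) {..<n}"
    using L2_set_triangle_ineq[of "\<lambda>i. x i - y i" "\<lambda>i. y i - z i" "{..<n}"] by simp
qed

lemma mspace_euclidean_n [simp]: "mspace (euclidean_n n) = topspace (Euclidean_space n)"
  unfolding euclidean_n_def by (rule Metric_space.mspace_metric[OF Metric_space_euclidean_n])

lemma mdist_euclidean_n [simp]: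
  "mdist (euclidean_n n) = (\<lambda>x y. L2_set (\<lambda>i. x i - y i) {..<n})"
  unfolding euclidean_n_def by (rule Metric_space.mdist_metric[OF Metric_space_euclidean_n])

lemma Metric_space_max_product:
  fixes X :: "nat \<Rightarrow> 'a metric"
  shows "Metric_space (\<Pi>\<^sub>E i\<in>{..<n}. mspace (X i))
     (\<lambda>x y. Max (insert 0 ((\<lambda>i. mdist (X i) (x i) (y i)) ` {..<n})))"
  (is "Metric_space ?M ?d")
proof
  fix x y z :: "nat \<Rightarrow> 'a"
  have le: "mdist (X i) (u i) (v i) \<le> ?d u v" if "i < n" for i u v
    using that by (intro Max_ge) auto
  show nonneg: "0 \<le> ?d x y"
    by (intro Max_ge) auto
  show "?d x y = ?d y x"
    by (simp add: mdist_commute)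
  show "(?d x y = 0) = (x = y)" if x: "x \<in> ?M" and y: "y \<in> ?M"
  proof
    assume 0: "?d x y = 0"
    show "x = y"
    proof (rule PiE_ext[OF x y])
      fix i assume i: "i \<in> {..<n}"
      then have "mdist (X i) (x i) (y i) = 0"
        using le[of i x y] 0 mdist_nonneg[of "X i" "x i" "y i"] by simp
      then show "x i = y i"
        using x y i by (meson PiE_mem mdist_zero)
    qed
  next
    assume "x = y"
    have "(\<lambda>i. mdist (X i) (x i) (x i)) ` {..<n} \<subseteq> {0}"
      using x by (auto intro: mdist_zero[THEN iffD2])
    then have "insert 0 ((\<lambda>i. mdist (X i) (x i) (x i)) ` {..<n}) = {0}"
      by auto
    then show "?d x y = 0"
      unfolding \<open>x = y\<close>[symmetric] by (simp only: Max_singleton)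
  qed
  show "?d x z \<le> ?d x y + ?d y z" if "x \<in> ?M" "y \<in> ?M" "z \<in> ?M"
  proof (rule Max.boundedI)
    fix a assume "a \<in> insert 0 ((\<lambda>i. mdist (X i) (x i) (z i)) ` {..<n})"
    then consider "a = 0" | i where "i < n" "a = mdist (X i) (x i) (z i)"
      by auto
    then show "a \<le> ?d x y + ?d y z"
    proof cases
      case 1
      then show ?thesis by (simp add: add_nonneg_nonneg)
    next
      case (2 i)
      have "mdist (X i) (x i) (z i) \<le> mdist (X i) (x i) (y i) + mdist (X i) (y i) (z i)"
        using that 2 by (intro mdist_triangle) auto
      then show ?thesis
        using le[of i x y] le[of i y z] 2 by linarith
    qed
  qed auto
qed

lemma mspace_max_product_metric [simp]:
  "mspace (max_product_metric n X) = (\<Pi>\<^sub>E i\<in>{..<n}. mspace (X i))"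
  unfolding max_product_metric_def
  by (rule Metric_space.mspace_metric[OF Metric_space_max_product])

lemma mdist_max_product_metric [simp]:
  "mdist (max_product_metric n X) =
     (\<lambda>x y. Max (insert 0 ((\<lambda>i. mdist (X i) (x i) (y i)) ` {..<n})))"
  unfolding max_product_metric_def
  by (rule Metric_space.mdist_metric[OF Metric_space_max_product])


section \<open>Snowflakes\<close>

definition snowflake_map :: "'a metric \<Rightarrow> 'b metric \<Rightarrow> ('a \<Rightarrow> 'b) \<Rightarrow> bool" where
  "snowflake_map X Y f \<longleftrightarrow> f \<in> mspace X \<rightarrow> mspace Y \<and>
     (\<exists>\<alpha> C :: real. 0 < \<alpha> \<and> \<alpha> \<le> 1 \<and> 0 < C \<and>
        (\<forall>x\<in>mspace X. \<forall>y\<in>mspace X.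
           inverse C * mdist X x y powr \<alpha> \<le> mdist Y (f x) (f y) \<and>
           mdist Y (f x) (f y) \<le> C * mdist X x y powr \<alpha>))"

definition snowflake_of :: "'b metric \<Rightarrow> 'a metric \<Rightarrow> bool" where
  "snowflake_of Y X \<longleftrightarrow> (\<exists>f. snowflake_map X Y f \<and> f ` mspace X = mspace Y)"


section \<open>Lipschitz dimension\<close>

definition r_path :: "'a metric \<Rightarrow> real \<Rightarrow> 'a list \<Rightarrow> bool" where
  "r_path X r xs \<longleftrightarrow> set xs \<subseteq> mspace X \<and>
     (\<forall>i. Suc i < length xs \<longrightarrow> mdist X (xs ! i) (xs ! Suc i) \<le> r)"

definition r_components :: "'a metric \<Rightarrow> real \<Rightarrow> 'a set set" where
  "r_components X r =
     mspace X // {(x, y). \<exists>xs. r_path X r xs \<and> x \<in> set xs \<and> y \<in> set xs}"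

definition Lipschitz_light :: "'a metric \<Rightarrow> 'b metric \<Rightarrow> ('a \<Rightarrow> 'b) \<Rightarrow> bool" where
  "Lipschitz_light X Y f \<longleftrightarrow> f \<in> mspace X \<rightarrow> mspace Y \<and>
     (\<exists>C>0.
        (\<forall>x\<in>mspace X. \<forall>y\<in>mspace X. mdist Y (f x) (f y) \<le> C * mdist X x y) \<and>
        (\<forall>r>0. \<forall>W\<subseteq>mspace Y. mdiameter Y W \<le> ennreal r \<longrightarrow>
           (\<forall>A\<in>r_components (submetric X {x \<in> mspace X. f x \<in> W}) r.
              mdiameter X A \<le> ennreal (C * r))))"

text \<open>In \<^typ>\<open>enat\<close>, \<^term>\<open>Inf {} = (\<infinity> :: enat)\<close>, and the infimum of a nonempty set is its
  least element.\<close>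

definition Lipschitz_dim :: "'a metric \<Rightarrow> enat" where
  "Lipschitz_dim X = Inf {enat n | n. \<exists>f. Lipschitz_light X (euclidean_n n) f}"

end

theory Submission
  imports Defs
begin

text \<open>Products of snowflakes of the line and snowflakes of Euclidean \<open>n\<close>-space are treated together, as
  spaces with coordinates \<open>u\<close> for which the distance is comparable to
  \<open>max\<^sub>i \<bar>u x i - u y i\<bar> powr \<alpha> i\<close> (\<open>hoelder_coords\<close>).

  The dimension is at most \<open>n\<close>. It suffices to find, for each exponent \<open>\<alpha>\<close>, a function \<open>h\<close> on the line which is
  \<open>\<alpha>\<close>-Hoelder and whose oscillation on every interval of length \<open>L\<close> is at least a constant times
  \<open>L powr \<alpha>\<close>. Hoelder continuity is the Lipschitz condition on the snowflake. If a chain with steps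
  \<open>s\<close> covers a distance that is large compared with \<open>s\<close>, then it comes close to points where \<open>h\<close> differs by much
  more than \<open>s powr \<alpha>\<close>, so \<open>h\<close> cannot keep it inside a small set; this is lightness
  (\<open>oscillation_bounds_chains\<close>). For \<open>\<alpha> < 1\<close>, such an \<open>h\<close> is the Weierstrass series summed over all
  integer frequencies, which is exactly self-similar
  (\<open>oscillating_hoelder_function\<close>). Applying such functions coordinatewise gives the light map.

  The dimension is at least \<open>n\<close> for a topological reason, in a quantitative form. Given a Lipschitz light map to Euclidean \<open>m\<close>-space with \<open>m < n\<close>, cover the
  target by \<open>m + 1 \<le> n\<close> colours of small, mutually separated bricks (\<open>coloured_bricks\<close>) and
  colour a fine grid in the unit cube by the colours of the images. By the \<open>n\<close>-dimensional Hex
  theorem, which follows from Kuhn's combinatorial lemma (\<open>hex_crossing\<close>), some colour joins two opposite faces.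
  Such a crossing lies over a single brick, and so contradicts lightness at the scale of the bricks
  (\<open>hoelder_coords_dim_le\<close>).\<close>

section \<open>Lipschitz light maps in terms of paths\<close>

lemma mdiameter_le_iff:
  assumes "0 \<le> r"
  shows "mdiameter X S \<le> ennreal r \<longleftrightarrow> (\<forall>x\<in>S. \<forall>y\<in>S. mdist X x y \<le> r)"
  using assms by (auto simp: mdiameter_def SUP_le_iff)

lemma r_path_submetric:
  "r_path (submetric X S) r xs \<longleftrightarrow> r_path X r xs \<and> set xs \<subseteq> S"
  by (auto simp: r_path_def)

text \<open>Lightness in terms of single paths, with neither components nor diameters: apply the definition with \<open>W\<close>
  the image of the path.\<close>

lemma Lipschitz_lightD:
  assumes "Lipschitz_light X Y f"
  obtains C where "C > 0" "f \<in> mspace X \<rightarrow> mspace Y"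
    "\<And>x y. x \<in> mspace X \<Longrightarrow> y \<in> mspace X \<Longrightarrow> mdist Y (f x) (f y) \<le> C * mdist X x y"
    "\<And>r xs x y. r > 0 \<Longrightarrow> r_path X r xs \<Longrightarrow>
       (\<And>x y. x \<in> set xs \<Longrightarrow> y \<in> set xs \<Longrightarrow> mdist Y (f x) (f y) \<le> r) \<Longrightarrow>
       x \<in> set xs \<Longrightarrow> y \<in> set xs \<Longrightarrow> mdist X x y \<le> C * r"
proof -
  obtain C where C: "C > 0" and f: "f \<in> mspace X \<rightarrow> mspace Y"
    and lip: "\<forall>x\<in>mspace X. \<forall>y\<in>mspace X. mdist Y (f x) (f y) \<le> C * mdist X x y"
    and light: "\<forall>r>0. \<forall>W\<subseteq>mspace Y. mdiameter Y W \<le> ennreal r \<longrightarrow>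
           (\<forall>A\<in>r_components (submetric X {x \<in> mspace X. f x \<in> W}) r.
              mdiameter X A \<le> ennreal (C * r))"
    using assms unfolding Lipschitz_light_def by blast
  show thesis
  proof (rule that[OF C f])
    show "mdist Y (f x) (f y) \<le> C * mdist X x y" if "x \<in> mspace X" "y \<in> mspace X" for x y
      using lip that by blast
    fix r :: real and xs x y
    assume r: "r > 0" and xs: "r_path X r xs"
      and diam: "\<And>x y. x \<in> set xs \<Longrightarrow> y \<in> set xs \<Longrightarrow> mdist Y (f x) (f y) \<le> r"
      and x: "x \<in> set xs" and y: "y \<in> set xs"
    define W where "W = f ` set xs"
    define S where "S = submetric X {x \<in> mspace X. f x \<in> W}"
    define A where "A = {(x, y). \<exists>xs. r_path S r xs \<and> x \<in> set xs \<and> y \<in> set xs} `` {x}"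
    have sub: "set xs \<subseteq> mspace X"
      using xs by (auto simp: r_path_def)
    have W: "W \<subseteq> mspace Y" "mdiameter Y W \<le> ennreal r"
      using f sub r diam by (auto simp: W_def mdiameter_le_iff)
    have xsS: "r_path S r xs"
      using xs sub by (auto simp: S_def r_path_submetric W_def)
    have "x \<in> mspace S"
      using x sub by (auto simp: S_def W_def)
    then have "A \<in> r_components S r"
      unfolding A_def r_components_def by (rule quotientI)
    then have "mdiameter X A \<le> ennreal (C * r)"
      using light r W unfolding S_def by blast
    moreover have "x \<in> A" "y \<in> A"
      unfolding A_def using xsS x y by blast+
    ultimately show "mdist X x y \<le> C * r"
      using C r by (simp add: mdiameter_le_iff)
  qed
qed

text \<open>Conversely, the path formulation with constant \<open>C\<close> gives lightness with constant \<open>2 * C\<close>: any two points of a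
  component are joined by a path to a common third point.\<close>

lemma Lipschitz_lightI:
  assumes f: "f \<in> mspace X \<rightarrow> mspace Y" and C: "C > 0"
    and lip: "\<And>x y. x \<in> mspace X \<Longrightarrow> y \<in> mspace X \<Longrightarrow> mdist Y (f x) (f y) \<le> C * mdist X x y"
    and light: "\<And>r xs x y. r > 0 \<Longrightarrow> r_path X r xs \<Longrightarrow>
       (\<And>x y. x \<in> set xs \<Longrightarrow> y \<in> set xs \<Longrightarrow> mdist Y (f x) (f y) \<le> r) \<Longrightarrow>
       x \<in> set xs \<Longrightarrow> y \<in> set xs \<Longrightarrow> mdist X x y \<le> C * r"
  shows "Lipschitz_light X Y f"
  unfolding Lipschitz_light_def
proof (intro conjI exI[of _ "2 * C"] ballI allI impI)
  show "f \<in> mspace X \<rightarrow> mspace Y" "0 < 2 * C"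
    using f C by auto
  show "mdist Y (f x) (f y) \<le> 2 * C * mdist X x y" if "x \<in> mspace X" "y \<in> mspace X" for x y
    using lip[OF that] mult_nonneg_nonneg[OF less_imp_le[OF C] mdist_nonneg[of X x y]] by linarith
  fix r :: real and W A
  define S where "S = submetric X {x \<in> mspace X. f x \<in> W}"
  assume r: "0 < r" and W: "W \<subseteq> mspace Y" "mdiameter Y W \<le> ennreal r"
    and "A \<in> r_components (submetric X {x \<in> mspace X. f x \<in> W}) r"
  then obtain x where x: "x \<in> mspace S"
    and A: "A = {(x, y). \<exists>xs. r_path S r xs \<and> x \<in> set xs \<and> y \<in> set xs} `` {x}"
    unfolding S_def[symmetric] r_components_def by (rule_tac quotientE) blast+
  have near: "mdist X x y \<le> C * r \<and> y \<in> mspace X" if y: "y \<in> A" for y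
  proof -
    obtain xs where xs: "r_path S r xs" "x \<in> set xs" "y \<in> set xs"
      using y unfolding A by blast
    then have "r_path X r xs" and sub: "set xs \<subseteq> {x \<in> mspace X. f x \<in> W}"
      by (auto simp: S_def r_path_submetric)
    moreover have "mdist Y (f u) (f v) \<le> r" if "u \<in> set xs" "v \<in> set xs" for u v
      using W sub that r by (auto simp: mdiameter_le_iff)
    ultimately show ?thesis
      using light[of r xs x y] r xs by blast
  qed
  have "mdist X y z \<le> 2 * C * r" if "y \<in> A" "z \<in> A" for y z
  proof -
    have "mdist X y z \<le> mdist X y x + mdist X x z"
      using near that x by (intro mdist_triangle) (auto simp: S_def)
    then show ?thesis
      using near[OF that(1)] near[OF that(2)] by (simp add: mdist_commute)
  qed
  then show "mdiameter X A \<le> ennreal (2 * C * r)"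
    using C r by (simp add: mdiameter_le_iff)
qed

lemma r_path_snoc:
  assumes "r_path X r xs" "xs \<noteq> []" "z \<in> mspace X" "mdist X (last xs) z \<le> r"
  shows "r_path X r (xs @ [z])"
  unfolding r_path_def
proof (intro conjI allI impI)
  show "set (xs @ [z]) \<subseteq> mspace X"
    using assms by (auto simp: r_path_def)
  fix i assume i: "Suc i < length (xs @ [z])"
  show "mdist X ((xs @ [z]) ! i) ((xs @ [z]) ! Suc i) \<le> r"
  proof (cases "Suc i < length xs")
    case True
    then show ?thesis
      using assms(1) by (simp add: r_path_def nth_append)
  next
    case False
    then have "i = length xs - 1" "Suc i = length xs"
      using i assms(2) by auto
    then show ?thesis
      using assms(2,4) by (simp add: nth_append last_conv_nth)
  qed
qed

section \<open>Hoelder coordinates on snowflakes\<close>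

text \<open>The common structure of the two families of spaces: up to the factor \<open>C\<close>, \<open>X\<close> carries the metric
  \<open>max\<^sub>i \<bar>u x i - u y i\<bar> powr \<alpha> i\<close> in real coordinates \<open>u\<close> that take all values in \<open>n\<close>-space. The upper
  bound quantifies over \<open>t\<close> in place of a maximum.\<close>

definition hoelder_coords ::
  "nat \<Rightarrow> (nat \<Rightarrow> real) \<Rightarrow> real \<Rightarrow> 'a metric \<Rightarrow> ('a \<Rightarrow> nat \<Rightarrow> real) \<Rightarrow> bool" where
  "hoelder_coords n \<alpha> C X u \<longleftrightarrow>
     (\<forall>i<n. 0 < \<alpha> i \<and> \<alpha> i \<le> 1) \<and> 0 < C \<and>
     (\<forall>v. \<exists>x\<in>mspace X. \<forall>i<n. u x i = v i) \<and>
     (\<forall>x\<in>mspace X. \<forall>y\<in>mspace X. \<forall>i<n. \<bar>u x i - u y i\<bar> powr \<alpha> i \<le> C * mdist X x y) \<and>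
     (\<forall>x\<in>mspace X. \<forall>y\<in>mspace X. \<forall>t\<ge>0.
        (\<forall>i<n. \<bar>u x i - u y i\<bar> powr \<alpha> i \<le> t) \<longrightarrow> mdist X x y \<le> C * t)"

lemma abs_le_L2_set:
  fixes x :: "nat \<Rightarrow> real"
  assumes "i < n"
  shows "\<bar>x i\<bar> \<le> L2_set x {..<n}"
proof -
  have "\<bar>x i\<bar> = L2_set x {i}"
    by (simp add: L2_set_def)
  also have "\<dots> \<le> L2_set x {..<n}"
    unfolding L2_set_def using assms by (intro real_sqrt_le_mono sum_mono2) auto
  finally show ?thesis .
qed

text \<open>A snowflake map is injective by its lower bound, so a snowflake can be described by the inverse map,
  whose values serve as coordinates.\<close>

lemma snowflake_of_inverse:
  assumes "snowflake_of Y X"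
  obtains g \<alpha> C where "g \<in> mspace Y \<rightarrow> mspace X" "0 < \<alpha>" "\<alpha> \<le> 1" "0 < C"
    "\<And>a. a \<in> mspace X \<Longrightarrow> \<exists>y\<in>mspace Y. g y = a"
    "\<And>x y. x \<in> mspace Y \<Longrightarrow> y \<in> mspace Y \<Longrightarrow> mdist X (g x) (g y) powr \<alpha> \<le> C * mdist Y x y"
    "\<And>x y. x \<in> mspace Y \<Longrightarrow> y \<in> mspace Y \<Longrightarrow> mdist Y x y \<le> C * mdist X (g x) (g y) powr \<alpha>"
proof -
  obtain f \<alpha> C where f: "f ` mspace X = mspace Y" and \<alpha>: "0 < \<alpha>" "\<alpha> \<le> 1" and C: "0 < C"
    and bd: "\<And>x y. x \<in> mspace X \<Longrightarrow> y \<in> mspace X \<Longrightarrow>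
           inverse C * mdist X x y powr \<alpha> \<le> mdist Y (f x) (f y) \<and>
           mdist Y (f x) (f y) \<le> C * mdist X x y powr \<alpha>"
    using assms unfolding snowflake_of_def snowflake_map_def by blast
  define g where "g = inv_into (mspace X) f"
  have g: "g y \<in> mspace X" "f (g y) = y" if "y \<in> mspace Y" for y
    using that f unfolding g_def by (auto intro: inv_into_into f_inv_into_f)
  have inj: "inj_on f (mspace X)"
  proof
    fix x y assume xy: "x \<in> mspace X" "y \<in> mspace X" "f x = f y"
    then have "mdist Y (f x) (f y) = 0"
      using f by (metis image_eqI mdist_zero)
    then have "inverse C * mdist X x y powr \<alpha> \<le> 0"
      using bd[of x y] xy by simp
    then have "mdist X x y powr \<alpha> \<le> 0"
      using C by (simp add: mult_le_0_iff)
    then have "mdist X x y = 0"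
      by (simp add: powr_eq_0_iff antisym)
    then show "x = y"
      using xy by simp
  qed
  show thesis
  proof (rule that[OF _ \<alpha> C])
    show "g \<in> mspace Y \<rightarrow> mspace X"
      using g by auto
    show "\<exists>y\<in>mspace Y. g y = a" if "a \<in> mspace X" for a
      using that inj f unfolding g_def by (intro bexI[of _ "f a"]) auto
    fix x y assume "x \<in> mspace Y" "y \<in> mspace Y"
    then show "mdist X (g x) (g y) powr \<alpha> \<le> C * mdist Y x y"
        "mdist Y x y \<le> C * mdist X (g x) (g y) powr \<alpha>"
      using bd[of "g x" "g y"] g C by (auto simp: field_simps)
  qed
qed

lemma product_of_snowflakes_coords:
  fixes Y :: "nat \<Rightarrow> 'a metric"
  assumes "\<forall>i<n. snowflake_of (Y i) (euclidean_metric :: real metric)"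
  obtains \<alpha> C u where "hoelder_coords n \<alpha> C (max_product_metric n Y) u"
proof -
  have "\<forall>i\<in>{..<n}. \<exists>g \<alpha> C. 0 < \<alpha> \<and> \<alpha> \<le> 1 \<and> 0 < C \<and> (\<forall>a::real. \<exists>y\<in>mspace (Y i). g y = a) \<and>
     (\<forall>x\<in>mspace (Y i). \<forall>y\<in>mspace (Y i). \<bar>g x - g y\<bar> powr \<alpha> \<le> C * mdist (Y i) x y \<and>
        mdist (Y i) x y \<le> C * \<bar>g x - g y\<bar> powr \<alpha>)"
  proof
    fix i assume "i \<in> {..<n}"
    then have "snowflake_of (Y i) (euclidean_metric :: real metric)"
      using assms by simp
    then show "\<exists>g \<alpha> C. 0 < \<alpha> \<and> \<alpha> \<le> 1 \<and> 0 < C \<and> (\<forall>a::real. \<exists>y\<in>mspace (Y i). g y = a) \<and>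
     (\<forall>x\<in>mspace (Y i). \<forall>y\<in>mspace (Y i). \<bar>g x - g y\<bar> powr \<alpha> \<le> C * mdist (Y i) x y \<and>
        mdist (Y i) x y \<le> C * \<bar>g x - g y\<bar> powr \<alpha>)"
      by (rule snowflake_of_inverse) (auto simp: dist_real_def, blast)
  qed
  from bchoice[OF this] obtain g where "\<forall>i\<in>{..<n}. \<exists>\<alpha> C. 0 < \<alpha> \<and> \<alpha> \<le> 1 \<and> 0 < C \<and>
     (\<forall>a::real. \<exists>y\<in>mspace (Y i). g i y = a) \<and>
     (\<forall>x\<in>mspace (Y i). \<forall>y\<in>mspace (Y i). \<bar>g i x - g i y\<bar> powr \<alpha> \<le> C * mdist (Y i) x y \<and>
        mdist (Y i) x y \<le> C * \<bar>g i x - g i y\<bar> powr \<alpha>)" ..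
  from bchoice[OF this] obtain \<alpha> where "\<forall>i\<in>{..<n}. \<exists>C. 0 < \<alpha> i \<and> \<alpha> i \<le> 1 \<and> 0 < C \<and>
     (\<forall>a::real. \<exists>y\<in>mspace (Y i). g i y = a) \<and>
     (\<forall>x\<in>mspace (Y i). \<forall>y\<in>mspace (Y i). \<bar>g i x - g i y\<bar> powr \<alpha> i \<le> C * mdist (Y i) x y \<and>
        mdist (Y i) x y \<le> C * \<bar>g i x - g i y\<bar> powr \<alpha> i)" ..
  from bchoice[OF this] obtain C where "\<forall>i\<in>{..<n}. 0 < \<alpha> i \<and> \<alpha> i \<le> 1 \<and> 0 < C i \<and>
     (\<forall>a::real. \<exists>y\<in>mspace (Y i). g i y = a) \<and>
     (\<forall>x\<in>mspace (Y i). \<forall>y\<in>mspace (Y i). \<bar>g i x - g i y\<bar> powr \<alpha> i \<le> C i * mdist (Y i) x y \<and>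
        mdist (Y i) x y \<le> C i * \<bar>g i x - g i y\<bar> powr \<alpha> i)" ..
  then have \<alpha>: "\<And>i. i < n \<Longrightarrow> 0 < \<alpha> i \<and> \<alpha> i \<le> 1" and C: "\<And>i. i < n \<Longrightarrow> 0 < C i"
    and surj: "\<And>i a. i < n \<Longrightarrow> \<exists>y\<in>mspace (Y i). g i y = (a::real)"
    and g1: "\<And>i x y. i < n \<Longrightarrow> x\<in>mspace (Y i) \<Longrightarrow> y\<in>mspace (Y i) \<Longrightarrow>
        \<bar>g i x - g i y\<bar> powr \<alpha> i \<le> C i * mdist (Y i) x y"
    and g2: "\<And>i x y. i < n \<Longrightarrow> x\<in>mspace (Y i) \<Longrightarrow> y\<in>mspace (Y i) \<Longrightarrow>
        mdist (Y i) x y \<le> C i * \<bar>g i x - g i y\<bar> powr \<alpha> i"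
    by blast+
  \<comment> \<open>A constant that serves for all factors; \<open>1\<close> keeps it positive when there are none.\<close>
  define D where "D = 1 + (\<Sum>i<n. C i)"
  have D: "C i \<le> D" if "i < n" for i
  proof -
    have "C i \<le> (\<Sum>i<n. C i)"
      using that C by (intro member_le_sum) (auto intro: less_imp_le)
    then show ?thesis
      by (simp add: D_def)
  qed
  have "0 < D"
    unfolding D_def using C by (intro add_pos_nonneg sum_nonneg) (auto intro: less_imp_le)
  let ?P = "max_product_metric n Y"
  have "hoelder_coords n \<alpha> D ?P (\<lambda>x i. g i (x i))"
    unfolding hoelder_coords_def
  proof (intro conjI allI impI ballI \<open>0 < D\<close>)
    show "0 < \<alpha> i" "\<alpha> i \<le> 1" if "i < n" for i
      using \<alpha> that by auto
    show "\<exists>x\<in>mspace ?P. \<forall>i<n. g i (x i) = v i" for v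
    proof -
      have "\<forall>i. \<exists>y. i < n \<longrightarrow> y \<in> mspace (Y i) \<and> g i y = v i"
        using surj by blast
      then obtain y where "\<forall>i<n. y i \<in> mspace (Y i) \<and> g i (y i) = v i"
        by metis
      then show ?thesis
        by (intro bexI[of _ "restrict y {..<n}"]) auto
    qed
    fix x y assume x: "x \<in> mspace ?P" and y: "y \<in> mspace ?P"
    then have mem: "x i \<in> mspace (Y i)" "y i \<in> mspace (Y i)" if "i < n" for i
      using that by auto
    show "\<bar>g i (x i) - g i (y i)\<bar> powr \<alpha> i \<le> D * mdist ?P x y" if i: "i < n" for i
    proof -
      have "mdist (Y i) (x i) (y i) \<le> mdist ?P x y"
        using i unfolding mdist_max_product_metric by (intro Max_ge) auto
      then have "C i * mdist (Y i) (x i) (y i) \<le> D * mdist ?P x y"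
        using D[OF i] \<open>0 < D\<close> by (intro mult_mono) auto
      then show ?thesis
        using g1[OF i mem[OF i]] by linarith
    qed
    fix t :: real assume t: "0 \<le> t" and le: "\<forall>i<n. \<bar>g i (x i) - g i (y i)\<bar> powr \<alpha> i \<le> t"
    show "mdist ?P x y \<le> D * t"
      unfolding mdist_max_product_metric
    proof (rule Max.boundedI)
      fix a assume "a \<in> insert 0 ((\<lambda>i. mdist (Y i) (x i) (y i)) ` {..<n})"
      then consider "a = 0" | i where "i < n" "a = mdist (Y i) (x i) (y i)"
        by auto
      then show "a \<le> D * t"
      proof cases
        case (2 i)
        have "C i * \<bar>g i (x i) - g i (y i)\<bar> powr \<alpha> i \<le> D * t"
          using D[of i] 2 le \<open>0 < D\<close> by (intro mult_mono) auto
        then show ?thesis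
          using g2[OF 2(1) mem[OF 2(1)]] 2 by linarith
      qed (use t \<open>0 < D\<close> in auto)
    qed auto
  qed
  then show thesis
    by (rule that)
qed

lemma snowflake_of_euclidean_coords:
  assumes "snowflake_of Z (euclidean_n n)"
  obtains \<alpha> C u where "hoelder_coords n \<alpha> C Z u"
proof -
  obtain g \<alpha> C where g: "g \<in> mspace Z \<rightarrow> topspace (Euclidean_space n)"
    and \<alpha>: "0 < \<alpha>" "\<alpha> \<le> 1" and C: "0 < C"
    and surj: "\<And>a. a \<in> topspace (Euclidean_space n) \<Longrightarrow> \<exists>y\<in>mspace Z. g y = a"
    and g1: "\<And>x y. x \<in> mspace Z \<Longrightarrow> y \<in> mspace Z \<Longrightarrow>
      L2_set (\<lambda>i. g x i - g y i) {..<n} powr \<alpha> \<le> C * mdist Z x y"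
    and g2: "\<And>x y. x \<in> mspace Z \<Longrightarrow> y \<in> mspace Z \<Longrightarrow>
      mdist Z x y \<le> C * L2_set (\<lambda>i. g x i - g y i) {..<n} powr \<alpha>"
    by (rule snowflake_of_inverse[OF assms]) auto
  \<comment> \<open>The factor \<open>1 + n\<close> pays for comparing the Euclidean norm with the maximum norm.\<close>
  define D where "D = C * (1 + real n)"
  have D: "0 < D" "C \<le> D"
    using C by (auto simp: D_def distrib_left intro: add_pos_nonneg)
  have "hoelder_coords n (\<lambda>i. \<alpha>) D Z g"
    unfolding hoelder_coords_def
  proof (intro conjI allI impI ballI \<alpha> D)
    show "\<exists>x\<in>mspace Z. \<forall>i<n. g x i = v i" for v
    proof -
      have "(\<lambda>i. if i < n then v i else 0) \<in> topspace (Euclidean_space n)"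
        by (simp add: topspace_Euclidean_space)
      from surj[OF this] obtain y where "y \<in> mspace Z" "g y = (\<lambda>i. if i < n then v i else 0)" ..
      then show ?thesis
        by (intro bexI[of _ y]) auto
    qed
    fix x y assume x: "x \<in> mspace Z" and y: "y \<in> mspace Z"
    show "\<bar>g x i - g y i\<bar> powr \<alpha> \<le> D * mdist Z x y" if i: "i < n" for i
    proof -
      have "\<bar>g x i - g y i\<bar> powr \<alpha> \<le> L2_set (\<lambda>i. g x i - g y i) {..<n} powr \<alpha>"
        using \<alpha> abs_le_L2_set[OF i, of "\<lambda>i. g x i - g y i"] by (intro powr_mono2) auto
      also have "\<dots> \<le> C * mdist Z x y"
        by (rule g1[OF x y])
      also have "\<dots> \<le> D * mdist Z x y"
        using D by (intro mult_right_mono) auto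
      finally show ?thesis .
    qed
    fix t :: real assume t: "0 \<le> t" and le: "\<forall>i<n. \<bar>g x i - g y i\<bar> powr \<alpha> \<le> t"
    have "\<bar>g x i - g y i\<bar> \<le> t powr (1 / \<alpha>)" if "i < n" for i
    proof -
      have "\<bar>g x i - g y i\<bar> = (\<bar>g x i - g y i\<bar> powr \<alpha>) powr (1 / \<alpha>)"
        using \<alpha> by (simp add: powr_powr)
      also have "\<dots> \<le> t powr (1 / \<alpha>)"
        using le that \<alpha> by (intro powr_mono2) auto
      finally show ?thesis .
    qed
    then have "(\<Sum>i<n. \<bar>g x i - g y i\<bar>) \<le> real n * t powr (1 / \<alpha>)"
      using sum_bounded_above[of "{..<n}" "\<lambda>i. \<bar>g x i - g y i\<bar>" "t powr (1 / \<alpha>)"] by simp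
    then have "L2_set (\<lambda>i. g x i - g y i) {..<n} \<le> real n * t powr (1 / \<alpha>)"
      using L2_set_le_sum_abs[of "\<lambda>i. g x i - g y i" "{..<n}"] by linarith
    then have "L2_set (\<lambda>i. g x i - g y i) {..<n} powr \<alpha> \<le> (real n * t powr (1 / \<alpha>)) powr \<alpha>"
      using \<alpha> by (intro powr_mono2) auto
    also have "\<dots> = real n powr \<alpha> * t"
      using \<alpha> t by (simp add: powr_mult powr_powr)
    also have "real n powr \<alpha> \<le> (1 + real n) powr 1"
      using \<alpha> by (intro order.trans[OF powr_mono2[of \<alpha> "real n" "1 + real n"] powr_mono]) auto
    finally have "L2_set (\<lambda>i. g x i - g y i) {..<n} powr \<alpha> \<le> (1 + real n) * t"
      using t by (simp add: mult_right_mono)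
    then have "C * L2_set (\<lambda>i. g x i - g y i) {..<n} powr \<alpha> \<le> D * t"
      using C by (simp add: D_def mult.assoc)
    then show "mdist Z x y \<le> D * t"
      using g2[OF x y] by linarith
  qed
  then show thesis
    by (rule that)
qed

section \<open>Hoelder functions with large oscillation\<close>

text \<open>The two-sided Weierstrass series \<open>\<Sum>k\<in>\<int>. b powr (- k * \<alpha>) * sin (b powr k * x)\<close>, split at \<open>k = 0\<close> and written with
  \<open>p = b powr (- \<alpha>)\<close> and \<open>q = b powr (\<alpha> - 1)\<close>, so that \<open>b = 1 / (p q)\<close> and only natural powers occur.
  Frequencies tending to \<open>0\<close> are needed as well as those tending to infinity, because the line has to be
  controlled at arbitrarily large scales too. Below, \<open>p\<close> and \<open>q\<close> are at most \<open>1/11\<close>, which makes the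
  geometric tails \<open>p + p\<^sup>2 + \<dots>\<close> and \<open>q + q\<^sup>2 + \<dots>\<close> at most \<open>1/10\<close>.\<close>

definition weierstrass :: "real \<Rightarrow> real \<Rightarrow> real \<Rightarrow> real" where
  "weierstrass p q x =
     (\<Sum>k. p ^ k * sin (x / (p * q) ^ k)) + (\<Sum>k. sin ((p * q) ^ Suc k * x) / p ^ Suc k)"

context
  fixes p q :: real
  assumes p: "0 < p" "p \<le> 1/11" and q: "0 < q" "q \<le> 1/11"
begin

lemma summable_high: "summable (\<lambda>k. p ^ k * sin (x / (p * q) ^ k))"
proof (rule summable_comparison_test'[of "\<lambda>k. p ^ k"])
  show "summable (\<lambda>k. p ^ k)"
    using p by (simp add: summable_geometric)
  show "norm (p ^ k * sin (x / (p * q) ^ k)) \<le> p ^ k" for k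
    using p mult_left_le[OF abs_sin_le_one[of "x / (p * q) ^ k"], of "p ^ k"] by (simp add: abs_mult)
qed

text \<open>The low frequencies have large amplitudes, but their sum is nearly constant on bounded intervals: a wave of
  frequency \<open>(p q) ^ k\<close> and amplitude \<open>1 / p ^ k\<close> has slope at most \<open>q ^ k\<close>.\<close>

lemma low_term_bound:
  "\<bar>sin ((p * q) ^ Suc k * x) / p ^ Suc k - sin ((p * q) ^ Suc k * y) / p ^ Suc k\<bar>
     \<le> \<bar>x - y\<bar> * q ^ Suc k"
proof -
  have "\<bar>sin u - sin v\<bar> \<le> \<bar>u - v\<bar>" for u v :: real
  proof -
    have "sin u - sin v = 2 * sin ((u - v) / 2) * cos ((u + v) / 2)"
      by (rule sin_diff_sin)
    also have "\<bar>\<dots>\<bar> \<le> 2 * \<bar>(u - v) / 2\<bar> * 1"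
      unfolding abs_mult by (intro mult_mono abs_sin_x_le_abs_x abs_cos_le_one) auto
    finally show ?thesis by simp
  qed
  then have "\<bar>sin ((p * q) ^ Suc k * x) - sin ((p * q) ^ Suc k * y)\<bar> \<le> \<bar>(p * q) ^ Suc k * x - (p * q) ^ Suc k * y\<bar>"
    by blast
  also have "\<dots> = \<bar>x - y\<bar> * q ^ Suc k * p ^ Suc k"
    unfolding right_diff_distrib[symmetric] abs_mult power_mult_distrib
    using p q by simp
  finally show ?thesis
    using p by (simp add: diff_divide_distrib[symmetric] abs_mult pos_divide_le_eq del: power_Suc)
qed

lemma geometric_q: "summable (\<lambda>k. c * q ^ Suc k)" "(\<Sum>k. c * q ^ Suc k) = c * (q / (1 - q))"
proof -
  have "(\<lambda>k. c * q * q ^ k) sums (c * q * (1 / (1 - q)))"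
    using q by (intro sums_mult geometric_sums) auto
  then show "summable (\<lambda>k. c * q ^ Suc k)" "(\<Sum>k. c * q ^ Suc k) = c * (q / (1 - q))"
    by (auto simp: sums_iff mult_ac)
qed

lemma summable_low: "summable (\<lambda>k. sin ((p * q) ^ Suc k * x) / p ^ Suc k)"
proof (rule summable_comparison_test'[OF geometric_q(1)[of "\<bar>x\<bar>"]])
  show "norm (sin ((p * q) ^ Suc k * x) / p ^ Suc k) \<le> \<bar>x\<bar> * q ^ Suc k" for k
    using low_term_bound[of k x 0] by simp
qed

lemma weierstrass_low_diff:
  "\<bar>(\<Sum>k. sin ((p * q) ^ Suc k * x) / p ^ Suc k) - (\<Sum>k. sin ((p * q) ^ Suc k * y) / p ^ Suc k)\<bar>
     \<le> \<bar>x - y\<bar> / 10"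
proof -
  have "\<bar>(\<Sum>k. sin ((p * q) ^ Suc k * x) / p ^ Suc k) - (\<Sum>k. sin ((p * q) ^ Suc k * y) / p ^ Suc k)\<bar>
      = norm (\<Sum>k. sin ((p * q) ^ Suc k * x) / p ^ Suc k - sin ((p * q) ^ Suc k * y) / p ^ Suc k)"
    by (simp only: suminf_diff[OF summable_low summable_low, symmetric] real_norm_def)
  also have "\<dots> \<le> (\<Sum>k. \<bar>x - y\<bar> * q ^ Suc k)"
    by (rule norm_suminf_le[OF _ geometric_q(1)]) (simp only: real_norm_def low_term_bound)
  also have "\<dots> = \<bar>x - y\<bar> * (q / (1 - q))"
    by (rule geometric_q)
  also have "\<dots> \<le> \<bar>x - y\<bar> * (1 / 10)"
    using q by (intro mult_left_mono) (auto simp: field_simps)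
  finally show ?thesis by simp
qed

lemma weierstrass_tail_bound: "\<bar>\<Sum>k. p ^ Suc k * sin (x / (p * q) ^ Suc k)\<bar> \<le> 1 / 10"
proof -
  have s: "(\<lambda>k. p * p ^ k) sums (p * (1 / (1 - p)))"
    using p by (intro sums_mult geometric_sums) auto
  have "norm (\<Sum>k. p ^ Suc k * sin (x / (p * q) ^ Suc k)) \<le> (\<Sum>k. p * p ^ k)"
  proof (rule norm_suminf_le)
    show "norm (p ^ Suc k * sin (x / (p * q) ^ Suc k)) \<le> p * p ^ k" for k
      using p mult_left_le[OF abs_sin_le_one[of "x / (p * q) ^ Suc k"], of "p ^ Suc k"]
      by (simp add: abs_mult)
  qed (use s in \<open>simp add: sums_iff\<close>)
  also have "\<dots> = p * (1 / (1 - p))"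
    using s by (simp add: sums_iff)
  also have "\<dots> \<le> 1 / 10"
    using p by (simp add: field_simps)
  finally show ?thesis by simp
qed

lemma weierstrass_high_split:
  "(\<Sum>k. p ^ k * sin (x / (p * q) ^ k)) = sin x + (\<Sum>k. p ^ Suc k * sin (x / (p * q) ^ Suc k))"
  using suminf_split_head[OF summable_high[of x]] by simp

text \<open>On bounded intervals the series is dominated by its term \<open>k = 0\<close>: the higher frequencies have
  total amplitude at most \<open>1/10\<close>, and the lower ones together are \<open>1/10\<close>-Lipschitz.\<close>

lemma weierstrass_near_sin:
  "\<bar>(weierstrass p q x - weierstrass p q y) - (sin x - sin y)\<bar> \<le> (2 + \<bar>x - y\<bar>) / 10"
proof -
  have combine: "\<bar>z\<bar> \<le> (2 + d) / 10"
    if "z = a - b + c" "\<bar>c\<bar> \<le> d / 10" "\<bar>a\<bar> \<le> 1 / 10" "\<bar>b\<bar> \<le> 1 / 10" for z a b c d :: real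
    using that unfolding add_divide_distrib by linarith
  have "(weierstrass p q x - weierstrass p q y) - (sin x - sin y) =
     (\<Sum>k. p ^ Suc k * sin (x / (p * q) ^ Suc k)) - (\<Sum>k. p ^ Suc k * sin (y / (p * q) ^ Suc k)) +
     ((\<Sum>k. sin ((p * q) ^ Suc k * x) / p ^ Suc k) - (\<Sum>k. sin ((p * q) ^ Suc k * y) / p ^ Suc k))"
    unfolding weierstrass_def weierstrass_high_split by simp
  then show ?thesis
    using weierstrass_low_diff[of x y] weierstrass_tail_bound[of x] weierstrass_tail_bound[of y]
    by (rule combine)
qed

text \<open>Shifting the index of the two-sided sum. This equation carries estimates at unit scale over to
  every scale.\<close>

lemma weierstrass_self_similar: "p * weierstrass p q (x / (p * q)) = weierstrass p q x"
proof -
  have hi: "p * (\<Sum>k. p ^ k * sin (x / (p * q) / (p * q) ^ k)) =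
      (\<Sum>k. p ^ Suc k * sin (x / (p * q) ^ Suc k))"
    using suminf_mult[OF summable_high[of "x / (p * q)"], of p] by (simp add: mult_ac)
  have "(\<Sum>k. sin ((p * q) ^ Suc k * (x / (p * q))) / p ^ Suc k * p) =
        (\<Sum>k. sin ((p * q) ^ k * x) / p ^ k)"
    using p q by (simp add: field_simps)
  moreover have sm: "summable (\<lambda>k. sin ((p * q) ^ k * x) / p ^ k)"
    using summable_low[of x] by (subst (asm) summable_Suc_iff)
  ultimately have lo: "p * (\<Sum>k. sin ((p * q) ^ Suc k * (x / (p * q))) / p ^ Suc k) =
      sin x + (\<Sum>k. sin ((p * q) ^ Suc k * x) / p ^ Suc k)"
    using suminf_mult2[OF summable_low[of "x / (p * q)"], of p] suminf_split_head[OF sm]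
    by (simp add: mult.commute)
  show ?thesis
    unfolding weierstrass_def weierstrass_high_split[of x] distrib_left lo hi by simp
qed

lemma weierstrass_bounded: "\<bar>weierstrass p q x - weierstrass p q y\<bar> \<le> (22 + \<bar>x - y\<bar>) / 10"
proof -
  have "\<bar>w\<bar> \<le> (22 + d) / 10" if "\<bar>w - (a - b)\<bar> \<le> (2 + d) / 10" "\<bar>a\<bar> \<le> 1" "\<bar>b\<bar> \<le> 1" for w a b d :: real
    using that unfolding add_divide_distrib by linarith
  from this[OF weierstrass_near_sin abs_sin_le_one abs_sin_le_one] show ?thesis .
qed

text \<open>Of the two points \<open>a\<close> and \<open>a + \<pi>/2\<close>, one has a sine of absolute value at least \<open>1/2\<close>, and moving it by \<open>\<pi>\<close> flips
  the sign; the error terms cannot undo a change by \<open>1\<close>. Both points stay in the interval because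
  \<open>3 * \<pi> / 2 < 6\<close>.\<close>

lemma weierstrass_oscillates:
  obtains s t where "s \<in> {a..a + 6}" "t \<in> {a..a + 6}"
    "\<bar>weierstrass p q s - weierstrass p q t\<bar> \<ge> 1/5"
proof -
  have "(sin a)\<^sup>2 + (sin (a + pi / 2))\<^sup>2 = 1"
    by (simp add: sin_add)
  then have "\<bar>sin a\<bar> \<ge> 1/2 \<or> \<bar>sin (a + pi / 2)\<bar> \<ge> 1/2"
    using power_strict_mono[of "\<bar>sin a\<bar>" "1/2" 2] power_strict_mono[of "\<bar>sin (a + pi/2)\<bar>" "1/2" 2]
    by (force simp: power_divide)
  then obtain s where s: "a \<le> s" "s \<le> a + pi / 2" "\<bar>sin s\<bar> \<ge> 1/2"
    using pi_gt_zero by (metis add.right_neutral add_left_mono le_add_same_cancel1 less_eq_real_def half_gt_zero order_refl)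
  have separated: "1 / 5 \<le> \<bar>w\<bar>"
    if "1 \<le> \<bar>z\<bar>" "\<bar>w - z\<bar> \<le> (2 + d) / 10" "d < 4" for w z d :: real
    using that unfolding add_divide_distrib by linarith
  have "\<bar>sin s - sin (s + pi)\<bar> \<ge> 1"
    using s(3) by simp
  then have "\<bar>weierstrass p q s - weierstrass p q (s + pi)\<bar> \<ge> 1/5"
    using weierstrass_near_sin[of s "s + pi"] pi_less_4 pi_gt_zero
    by (intro separated[of "2 * sin s" _ pi]) auto
  then show thesis
    using s pi_less_4 pi_gt_zero by (intro that[of s "s + pi"]) auto
qed

end

text \<open>The exponent \<open>\<alpha>\<close> is sharp at every place and at every scale: on all intervals of length
  \<open>L\<close>, the oscillation of \<open>h\<close> has the exact order \<open>L powr \<alpha>\<close>.\<close>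

definition oscillating_hoelder :: "real \<Rightarrow> real \<Rightarrow> real \<Rightarrow> (real \<Rightarrow> real) \<Rightarrow> bool" where
  "oscillating_hoelder \<alpha> H c h \<longleftrightarrow> 0 < H \<and> 0 < c \<and>
     (\<forall>s t. \<bar>h s - h t\<bar> \<le> H * \<bar>s - t\<bar> powr \<alpha>) \<and>
     (\<forall>a L. 0 < L \<longrightarrow> (\<exists>s\<in>{a..a+L}. \<exists>t\<in>{a..a+L}. c * L powr \<alpha> \<le> \<bar>h s - h t\<bar>))"

lemma powr_int_scale:
  fixes b L :: real
  assumes "1 < b" "0 < L"
  obtains j :: int where "b powr j \<le> L" "L < b * b powr j"
proof (rule that[of "\<lfloor>log b L\<rfloor>"])
  show "b powr \<lfloor>log b L\<rfloor> \<le> L"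
    using assms by (simp add: powr_le_iff)
  have "L = b powr (log b L)"
    using assms by simp
  also have "\<dots> < b powr (1 + \<lfloor>log b L\<rfloor>)"
    using assms by (intro powr_less_mono) linarith+
  also have "\<dots> = b * b powr \<lfloor>log b L\<rfloor>"
    using assms by (simp add: powr_add)
  finally show "L < b * b powr \<lfloor>log b L\<rfloor>" .
qed

text \<open>For \<open>\<alpha> = 1\<close> the identity serves. For \<open>\<alpha> < 1\<close>, take the Weierstrass series with a base \<open>b\<close> so large
  that both error terms are small; this is possible since \<open>\<alpha>\<close> and \<open>1 - \<alpha>\<close> are positive. Self-similarity
  reduces both estimates for a given length to lengths between \<open>1\<close> and \<open>b\<close>, up to a constant factor.\<close>

lemma oscillating_hoelder_function:
  fixes \<alpha> :: real
  assumes \<alpha>: "0 < \<alpha>" "\<alpha> \<le> 1"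
  obtains h H c where "oscillating_hoelder \<alpha> H c h"
proof (cases "\<alpha> = 1")
  case True
  show thesis
  proof (rule that[of 1 1 "\<lambda>x. x"], unfold oscillating_hoelder_def, intro conjI allI impI)
    show "\<exists>s\<in>{a..a+L}. \<exists>t\<in>{a..a+L}. 1 * L powr \<alpha> \<le> \<bar>s - t\<bar>" if "0 < L" for a L :: real
      using that True by (intro bexI[of _ a] bexI[of _ "a + L"]) auto
  qed (auto simp: True)
next
  case False
  define \<beta> where "\<beta> = min \<alpha> (1 - \<alpha>)"
  have \<beta>: "0 < \<beta>" "\<beta> \<le> \<alpha>" "\<beta> \<le> 1 - \<alpha>"
    using \<alpha> False by (auto simp: \<beta>_def)
  \<comment> \<open>So that \<open>b powr \<beta> = 11\<close>, and the ratios \<open>p\<close> and \<open>q\<close> below are at most \<open>1/11\<close>.\<close>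
  define b :: real where "b = 11 powr (1 / \<beta>)"
  have b: "1 < b"
    using \<beta> by (simp add: b_def)
  have b11: "11 \<le> b powr e" if "\<beta> \<le> e" for e
  proof -
    have "(11::real) = b powr \<beta>"
      using \<beta> by (simp add: b_def powr_powr)
    also have "\<dots> \<le> b powr e"
      using b that by (intro powr_mono) auto
    finally show ?thesis .
  qed
  define p where "p = b powr (- \<alpha>)"
  define q where "q = b powr (\<alpha> - 1)"
  have p: "0 < p" "p \<le> 1/11"
    using b b11[of \<alpha>] \<beta> by (auto simp: p_def powr_minus field_simps)
  have q: "0 < q" "q \<le> 1/11"
  proof -
    have "q = 1 / b powr (1 - \<alpha>)"
      by (simp add: q_def powr_minus_divide[symmetric])
    moreover have "11 \<le> b powr (1 - \<alpha>)"
      using b11 \<beta> by simp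
    ultimately show "0 < q" "q \<le> 1/11"
      by (auto intro!: divide_left_mono[of 11 _ 1, simplified])
  qed
  have pq: "p * q = 1 / b"
  proof -
    have "p * q = b powr (- 1)"
      unfolding p_def q_def powr_add[symmetric] by simp
    then show ?thesis
      using b by (simp add: powr_minus_divide)
  qed
  define h where "h = weierstrass p q"
  have step: "h (b * x) = b powr \<alpha> * h x" for x
  proof -
    have "p * h (b * x) = h x"
      using weierstrass_self_similar[OF p q, of x] by (simp add: h_def pq mult.commute)
    moreover have "b powr \<alpha> * p = 1"
      using b by (simp add: p_def powr_minus)
    ultimately show ?thesis
      by (metis mult.assoc mult_1)
  qed
  have scale_nat: "h (b ^ k * x) = (b powr \<alpha>) ^ k * h x" for k x
    by (induction k) (simp_all add: step mult.assoc)
  have scale: "h (b powr j * x) = (b powr j) powr \<alpha> * h x" for j :: int and x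
  proof (cases "0 \<le> j")
    case True
    then show ?thesis
      using scale_nat[of "nat j" x] b
      by (simp add: powr_realpow[symmetric] powr_powr mult.commute)
  next
    case False
    define k where "k = nat (- j)"
    have j: "real_of_int j = - real k"
      using False by (simp add: k_def)
    have "h x = (b powr \<alpha>) ^ k * h (b powr j * x)"
    proof -
      have "b ^ k * (b powr j * x) = x"
        using b by (simp add: j powr_minus powr_realpow)
      then show ?thesis
        using scale_nat[of k "b powr j * x"] by metis
    qed
    moreover have "(b powr j) powr \<alpha> * (b powr \<alpha>) ^ k = 1"
      using b by (simp add: j powr_powr powr_power powr_add[symmetric] mult.commute)
    ultimately show ?thesis
      by (metis mult.assoc mult_1)
  qed
  have scale_diff: "\<bar>h (b powr j * x) - h (b powr j * y)\<bar> = (b powr j) powr \<alpha> * \<bar>h x - h y\<bar>"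
    for j :: int and x y
    unfolding scale right_diff_distrib[symmetric] by (simp add: abs_mult)
  show thesis
  proof (rule that[of "(22 + b) / 10" "1 / 5 / (6 * b) powr \<alpha>" h],
      unfold oscillating_hoelder_def, intro conjI allI impI)
    show "0 < (22 + b) / 10" "0 < 1 / 5 / (6 * b) powr \<alpha>"
      using b by auto
    show "\<bar>h s - h t\<bar> \<le> (22 + b) / 10 * \<bar>s - t\<bar> powr \<alpha>" for s t
    proof (cases "s = t")
      case False
      then obtain j :: int where j: "b powr j \<le> \<bar>s - t\<bar>" "\<bar>s - t\<bar> < b * b powr j"
        using powr_int_scale[OF b, of "\<bar>s - t\<bar>"] by auto
      define m where "m = b powr j"
      have m: "0 < m"
        using b by (simp add: m_def)
      have "\<bar>s / m - t / m\<bar> \<le> b"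
        using j m by (simp add: m_def[symmetric] diff_divide_distrib[symmetric] pos_divide_le_eq)
      then have "\<bar>h (s / m) - h (t / m)\<bar> \<le> (22 + b) / 10"
        using weierstrass_bounded[OF p q, of "s / m" "t / m"] by (simp add: h_def)
      then have "m powr \<alpha> * \<bar>h (s / m) - h (t / m)\<bar> \<le> \<bar>s - t\<bar> powr \<alpha> * ((22 + b) / 10)"
        using j m \<alpha> by (intro mult_mono powr_mono2) (auto simp: m_def)
      then show ?thesis
        using scale_diff[of j "s / m" "t / m"] m by (simp add: m_def[symmetric] mult.commute)
    qed simp
    fix a L :: real assume L: "0 < L"
    obtain j :: int where j: "b powr j \<le> L / 6" "L / 6 < b * b powr j"
      using powr_int_scale[OF b, of "L / 6"] L by auto
    define m where "m = b powr j"
    have m: "0 < m" "m * 6 \<le> L" "L \<le> 6 * b * m"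
      using b j by (auto simp: m_def)
    obtain s t where st: "s \<in> {a / m..a / m + 6}" "t \<in> {a / m..a / m + 6}" "1/5 \<le> \<bar>h s - h t\<bar>"
      using weierstrass_oscillates[OF p q, of "a / m"] unfolding h_def by blast
    have mem: "m * s \<in> {a..a + L}" if "s \<in> {a / m..a / m + 6}" for s
    proof -
      have "a / m * m \<le> s * m"
        by (rule mult_right_mono) (use that m in auto)
      moreover have "s * m \<le> (a / m + 6) * m"
        by (rule mult_right_mono) (use that m in auto)
      moreover have "a / m * m = a"
        using m by simp
      ultimately have "a \<le> s * m" "s * m \<le> a + m * 6"
        unfolding distrib_right by simp_all
      then show ?thesis
        using m by (simp add: mult.commute)
    qed
    have "L powr \<alpha> \<le> (6 * b * m) powr \<alpha>"
      using m L \<alpha> by (intro powr_mono2) auto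
    also have "\<dots> = (6 * b) powr \<alpha> * m powr \<alpha>"
      using m b by (simp add: powr_mult)
    finally have "1 / 5 / (6 * b) powr \<alpha> * L powr \<alpha> \<le> m powr \<alpha> * (1 / 5)"
      using b by (simp add: field_simps)
    also have "\<dots> \<le> m powr \<alpha> * \<bar>h s - h t\<bar>"
      using st by (intro mult_left_mono) auto
    also have "\<dots> = \<bar>h (m * s) - h (m * t)\<bar>"
      by (simp add: m_def scale_diff)
    finally show "\<exists>s\<in>{a..a+L}. \<exists>t\<in>{a..a+L}. 1 / 5 / (6 * b) powr \<alpha> * L powr \<alpha> \<le> \<bar>h s - h t\<bar>"
      using mem st by blast
  qed
qed

text \<open>A step across \<open>s\<close> is at least as long as the distance from its starting point to \<open>s\<close>. So a chain that
  keeps away from \<open>s\<close> by more than its step length stays on one side of \<open>s\<close>.\<close>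

lemma discrete_intermediate_value:
  fixes z :: "nat \<Rightarrow> real"
  assumes "k < N" "l < N" "z k \<le> s" "s \<le> z l"
    and "\<And>j. Suc j < N \<Longrightarrow> \<bar>z j - z (Suc j)\<bar> powr \<alpha> \<le> r" and "0 < \<alpha>"
    and "0 \<le> r"
  obtains j where "j < N" "\<bar>z j - s\<bar> powr \<alpha> \<le> r"
proof (rule ccontr)
  note near = that
  assume no: "\<not> thesis"
  have far: "r < \<bar>z j - s\<bar> powr \<alpha>" if "j < N" for j
    using near[of j] that no by (rule_tac ccontr) simp
  have same: "z j < s \<longleftrightarrow> z (Suc j) < s" if "Suc j < N" for j
  proof (rule ccontr)
    assume "\<not> ?thesis"
    then have "\<bar>z j - s\<bar> \<le> \<bar>z j - z (Suc j)\<bar>"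
      by auto
    then have "\<bar>z j - s\<bar> powr \<alpha> \<le> \<bar>z j - z (Suc j)\<bar> powr \<alpha>"
      using \<open>0 < \<alpha>\<close> by (intro powr_mono2) auto
    then show False
      using far[of j] assms(5)[OF that] that by simp
  qed
  have all: "z j < s \<longleftrightarrow> z 0 < s" if "j < N" for j
    using that same by (induction j) auto
  have "z k \<noteq> s"
    using far[OF assms(1)] \<open>0 \<le> r\<close> by auto
  then have "z k < s"
    using assms by simp
  then have "z l < s"
    using all[OF assms(1)] all[OF assms(2)] by simp
  then show False
    using assms by simp
qed

text \<open>The step from oscillation to lightness. If a chain spans \<open>[z k, z l]\<close>, then it passes close to two points of
  that interval whose \<open>h\<close>-values are far apart, at least \<open>c * (z l - z k) powr \<alpha>\<close>. By Hoelder
  continuity the chain itself then sees almost this variation, which is bounded by assumption.\<close>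

lemma oscillation_bounds_chains:
  fixes z :: "nat \<Rightarrow> real" and h :: "real \<Rightarrow> real"
  assumes \<alpha>: "0 < \<alpha>" and "oscillating_hoelder \<alpha> H c h"
    and step: "\<And>j. Suc j < N \<Longrightarrow> \<bar>z j - z (Suc j)\<bar> powr \<alpha> \<le> r"
    and diam: "\<And>k l. k < N \<Longrightarrow> l < N \<Longrightarrow> \<bar>h (z k) - h (z l)\<bar> \<le> r'"
    and r: "0 \<le> r" "0 \<le> r'" and kl: "k < N" "l < N"
  shows "\<bar>z k - z l\<bar> powr \<alpha> \<le> (2 * H * r + r') / c"
proof -
  have H: "0 < H" and c: "0 < c"
    and hoelder: "\<And>s t. \<bar>h s - h t\<bar> \<le> H * \<bar>s - t\<bar> powr \<alpha>"
    and osc: "\<And>a L. 0 < L \<Longrightarrow> \<exists>s\<in>{a..a+L}. \<exists>t\<in>{a..a+L}. c * L powr \<alpha> \<le> \<bar>h s - h t\<bar>"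
    using assms(2) unfolding oscillating_hoelder_def by blast+
  have *: "(z l - z k) powr \<alpha> \<le> (2 * H * r + r') / c" if kl: "k < N" "l < N" "z k < z l" for k l
  proof -
    obtain s t where st: "s \<in> {z k..z l}" "t \<in> {z k..z l}" "c * (z l - z k) powr \<alpha> \<le> \<bar>h s - h t\<bar>"
      using osc[of "z l - z k" "z k"] kl by auto
    obtain i where i: "i < N" "\<bar>z i - s\<bar> powr \<alpha> \<le> r"
      using discrete_intermediate_value[of k N l z s \<alpha> r, OF kl(1,2) _ _ step \<alpha> r(1)] st by auto
    obtain j where j: "j < N" "\<bar>z j - t\<bar> powr \<alpha> \<le> r"
      using discrete_intermediate_value[of k N l z t \<alpha> r, OF kl(1,2) _ _ step \<alpha> r(1)] st by auto
    have "\<bar>h (z i) - h s\<bar> \<le> H * r" "\<bar>h (z j) - h t\<bar> \<le> H * r"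
      using hoelder[of "z i" s] hoelder[of "z j" t] i j H by (meson mult_left_mono less_imp_le order_trans)+
    moreover have "\<bar>h (z i) - h (z j)\<bar> \<le> r'"
      by (rule diam) fact+
    ultimately have "c * (z l - z k) powr \<alpha> \<le> 2 * H * r + r'"
      using st(3) by linarith
    then show ?thesis
      using c by (simp add: field_simps)
  qed
  consider "z k < z l" | "z l < z k" | "z k = z l"
    by linarith
  then show ?thesis
    using *[OF kl] *[OF kl(2,1)] c H r by cases (auto simp: abs_minus_commute)
qed

section \<open>The upper bound\<close>

text \<open>Apply in each coordinate an oscillating Hoelder function of the matching exponent. A coordinate of an
  \<open>r\<close>-path is a chain on the line, and its image varies by at most \<open>r\<close>, so that the chain is short.\<close>

lemma hoelder_coords_Lipschitz_light:
  assumes "hoelder_coords n \<alpha> C X u"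
  obtains f where "Lipschitz_light X (euclidean_n n) f"
proof -
  have \<alpha>: "\<And>i. i < n \<Longrightarrow> 0 < \<alpha> i \<and> \<alpha> i \<le> 1" and C: "0 < C"
    and u1: "\<And>x y i. x \<in> mspace X \<Longrightarrow> y \<in> mspace X \<Longrightarrow> i < n \<Longrightarrow>
          \<bar>u x i - u y i\<bar> powr \<alpha> i \<le> C * mdist X x y"
    and u2: "\<And>x y t. x \<in> mspace X \<Longrightarrow> y \<in> mspace X \<Longrightarrow> 0 \<le> t \<Longrightarrow>
        (\<And>i. i < n \<Longrightarrow> \<bar>u x i - u y i\<bar> powr \<alpha> i \<le> t) \<Longrightarrow> mdist X x y \<le> C * t"
    using assms unfolding hoelder_coords_def by blast+
  have "\<exists>h H c. oscillating_hoelder (\<alpha> i) H c h" if "i < n" for i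
    by (rule oscillating_hoelder_function[of "\<alpha> i"]) (use \<alpha> that in auto)
  then obtain h H c where osc: "\<And>i. i < n \<Longrightarrow> oscillating_hoelder (\<alpha> i) (H i) (c i) (h i)"
    by metis
  have H: "0 < H i" and c: "0 < c i"
    and h1: "\<And>s t. \<bar>h i s - h i t\<bar> \<le> H i * \<bar>s - t\<bar> powr \<alpha> i"
    if "i < n" for i
    using osc[OF that] unfolding oscillating_hoelder_def by blast+
  \<comment> \<open>\<open>A\<close> is the Lipschitz constant of \<open>f\<close>, \<open>C * K\<close> bounds the components, and \<open>1\<close> keeps the
    common constant positive.\<close>
  define f where "f x = (\<lambda>i. if i < n then h i (u x i) else 0)" for x
  define A where "A = (\<Sum>i<n. H i * C)"
  define K where "K = (\<Sum>i<n. (2 * H i * C + 1) / c i)"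
  have term_nonneg: "0 \<le> (2 * H i * C + 1) / c i" if "i < n" for i
    using H[OF that] c[OF that] C by simp
  have K_ge: "(2 * H i * C + 1) / c i \<le> K" if "i < n" for i
    unfolding K_def using that term_nonneg
    by (intro member_le_sum[of i "{..<n}" "\<lambda>i. (2 * H i * C + 1) / c i"]) auto
  have A: "0 \<le> A"
    unfolding A_def using H C by (intro sum_nonneg) (auto intro: less_imp_le)
  have K: "0 \<le> K"
    unfolding K_def using term_nonneg by (intro sum_nonneg) auto
  have "Lipschitz_light X (euclidean_n n) f"
  proof (rule Lipschitz_lightI[where C = "1 + A + C * K"])
    show "f \<in> mspace X \<rightarrow> mspace (euclidean_n n)"
      by (auto simp: f_def topspace_Euclidean_space)
    show "0 < 1 + A + C * K"
      using A K C by (intro add_pos_nonneg) auto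
    show "mdist (euclidean_n n) (f x) (f y) \<le> (1 + A + C * K) * mdist X x y"
      if xy: "x \<in> mspace X" "y \<in> mspace X" for x y
    proof -
      have "mdist (euclidean_n n) (f x) (f y) \<le> (\<Sum>i<n. \<bar>f x i - f y i\<bar>)"
        by (simp add: L2_set_le_sum_abs)
      also have "\<dots> \<le> (\<Sum>i<n. H i * C * mdist X x y)"
      proof (rule sum_mono)
        fix i assume "i \<in> {..<n}"
        then have i: "i < n"
          by simp
        have "\<bar>f x i - f y i\<bar> \<le> H i * \<bar>u x i - u y i\<bar> powr \<alpha> i"
          using h1[OF i] i by (simp add: f_def)
        also have "\<dots> \<le> H i * (C * mdist X x y)"
          using u1[OF xy i] H[OF i] by (intro mult_left_mono) auto
        finally show "\<bar>f x i - f y i\<bar> \<le> H i * C * mdist X x y"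
          by (simp add: mult.assoc)
      qed
      also have "\<dots> = A * mdist X x y"
        by (simp add: A_def sum_distrib_right)
      also have "\<dots> \<le> (1 + A + C * K) * mdist X x y"
        using K C by (intro mult_right_mono) auto
      finally show ?thesis .
    qed
    fix r :: real and xs x y
    assume r: "0 < r" and path: "r_path X r xs"
      and diam: "\<And>x y. x \<in> set xs \<Longrightarrow> y \<in> set xs \<Longrightarrow> mdist (euclidean_n n) (f x) (f y) \<le> r"
      and "x \<in> set xs" "y \<in> set xs"
    then obtain k l where k: "k < length xs" "x = xs ! k" and l: "l < length xs" "y = xs ! l"
      by (auto simp: in_set_conv_nth)
    have mem: "xs ! j \<in> mspace X" if "j < length xs" for j
      using path that by (auto simp: r_path_def)
    have "mdist X x y \<le> C * (K * r)"
    proof (rule u2)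
      show "x \<in> mspace X" "y \<in> mspace X"
        using k l mem by auto
      show "0 \<le> K * r"
        using K r by simp
      fix i assume i: "i < n"
      have "\<bar>u (xs ! k) i - u (xs ! l) i\<bar> powr \<alpha> i \<le> (2 * H i * (C * r) + r) / c i"
      proof (rule oscillation_bounds_chains[where N = "length xs" and h = "h i" and z = "\<lambda>j. u (xs ! j) i"])
        show "\<bar>u (xs ! j) i - u (xs ! Suc j) i\<bar> powr \<alpha> i \<le> C * r" if j: "Suc j < length xs" for j
        proof -
          have "\<bar>u (xs ! j) i - u (xs ! Suc j) i\<bar> powr \<alpha> i \<le> C * mdist X (xs ! j) (xs ! Suc j)"
            using j i mem by (intro u1) auto
          also have "\<dots> \<le> C * r"
            using C path j by (intro mult_left_mono) (auto simp: r_path_def)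
          finally show ?thesis .
        qed
        show "\<bar>h i (u (xs ! k) i) - h i (u (xs ! l) i)\<bar> \<le> r"
          if kl: "k < length xs" "l < length xs" for k l
        proof -
          have "\<bar>h i (u (xs ! k) i) - h i (u (xs ! l) i)\<bar> \<le> mdist (euclidean_n n) (f (xs ! k)) (f (xs ! l))"
            using abs_le_L2_set[OF i, of "\<lambda>i. f (xs ! k) i - f (xs ! l) i"] i by (simp add: f_def)
          also have "\<dots> \<le> r"
            using kl by (intro diam) auto
          finally show ?thesis .
        qed
      qed (use \<alpha> i osc C r k l in auto)
      also have "\<dots> = (2 * H i * C + 1) / c i * r"
        by (simp add: algebra_simps add_divide_distrib)
      also have "\<dots> \<le> K * r"
        using K_ge[OF i] r by (intro mult_right_mono) auto
      finally show "\<bar>u x i - u y i\<bar> powr \<alpha> i \<le> K * r"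
        using k l by simp
    qed
    also have "\<dots> \<le> (1 + A + C * K) * r"
      using A r by (simp add: algebra_simps)
    finally show "mdist X x y \<le> (1 + A + C * K) * r" .
  qed
  then show thesis
    by (rule that)
qed

section \<open>A Hex theorem for the grid\<close>

definition grid :: "nat \<Rightarrow> nat \<Rightarrow> (nat \<Rightarrow> nat) set" where
  "grid n p = {x. \<forall>i<n. x i \<le> p}"

definition grid_near :: "nat \<Rightarrow> nat \<Rightarrow> (nat \<Rightarrow> nat) \<Rightarrow> (nat \<Rightarrow> nat) \<Rightarrow> bool" where
  "grid_near n k x y \<longleftrightarrow> (\<forall>j<n. x j \<le> y j + k \<and> y j \<le> x j + k)"

definition colour_step ::
  "nat \<Rightarrow> nat \<Rightarrow> ((nat \<Rightarrow> nat) \<Rightarrow> nat) \<Rightarrow> nat \<Rightarrow> (nat \<Rightarrow> nat) \<Rightarrow> (nat \<Rightarrow> nat) \<Rightarrow> bool" where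
  "colour_step n p c i x y \<longleftrightarrow>
     x \<in> grid n p \<and> y \<in> grid n p \<and> c x = i \<and> c y = i \<and> grid_near n 2 x y"

text \<open>The Hex theorem in dimension \<open>n\<close>, for chains with steps of length at most 2: with \<open>n\<close> colours,
  some colour \<open>i\<close> connects the two faces orthogonal to direction \<open>i\<close> (up to a margin of 2). It is
  the combinatorial content of the Lebesgue covering theorem. The steps have length 2 because the proof meets a
  vertex of colour \<open>i\<close> in a cell that also has a neighbour of another vertex of colour \<open>i\<close>.\<close>

lemma hex_crossing:
  assumes p: "2 \<le> p" and col: "\<And>x. x \<in> grid n p \<Longrightarrow> c x < n"
  obtains i x y where "i < n" "x \<in> grid n p" "c x = i" "x i \<le> 2" "p \<le> y i + 1"
    "(colour_step n p c i)\<^sup>*\<^sup>* x y"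
proof (rule ccontr)
  note cross = that
  assume no: "\<not> thesis"
  then have none: "\<not> p \<le> y i + 1"
    if "i < n" "x \<in> grid n p" "c x = i" "x i \<le> 2"
    "(colour_step n p c i)\<^sup>*\<^sup>* x y" for i x y
    using cross[of i x y] that no by (rule_tac notI) simp
  \<comment> \<open>\<open>A i\<close>: the face \<open>x i = 0\<close> and all colour-\<open>i\<close> vertices linked to it. A vertex at distance
    2 from the face counts as linked, so that \<open>A i\<close> absorbs all colour-\<open>i\<close> vertices at distance 2 from
    it. The label of a vertex in direction \<open>i\<close> tells whether it has a neighbour in \<open>A i\<close>.\<close>
  define A where "A i = {y \<in> grid n p. y i = 0 \<or>
      (\<exists>x\<in>grid n p. c x = i \<and> x i \<le> 2 \<and> (colour_step n p c i)\<^sup>*\<^sup>* x y)}" for i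
  have A_I: "y \<in> A i" if "x \<in> grid n p" "c x = i" "x i \<le> 2" "(colour_step n p c i)\<^sup>*\<^sup>* x y" "y \<in> grid n p"
    for i x y
    unfolding A_def using that by blast
  have A_E: "a i = 0 \<or> (\<exists>x\<in>grid n p. c x = i \<and> x i \<le> 2 \<and> (colour_step n p c i)\<^sup>*\<^sup>* x a)"
    "a \<in> grid n p" if "a \<in> A i" for i a
    using that unfolding A_def by blast+
  define N where "N i = {x \<in> grid n p. \<exists>y\<in>A i. grid_near n 1 x y}" for i
  define label where "label x i = (if x \<in> N i then 0 else 1 :: nat)" for x i
  have near_A: "y \<in> A i" if y: "i < n" "a \<in> A i" "grid_near n 2 a y" "y \<in> grid n p" "c y = i" for i a y
  proof (cases "a i = 0")
    case True
    then have "y i \<le> 2"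
      using y(1,3) by (force simp: grid_near_def)
    then show ?thesis
      using A_I[of y i y] y by simp
  next
    case False
    then obtain x where x: "x \<in> grid n p" "c x = i" "x i \<le> 2" "(colour_step n p c i)\<^sup>*\<^sup>* x a"
      using A_E(1)[OF y(2)] False by blast
    have "c a = i"
      using x(4,2) by (induction rule: rtranclp_induct) (auto simp: colour_step_def)
    then have "colour_step n p c i a y"
      using y A_E(2)[OF y(2)] by (simp add: colour_step_def)
    then have "(colour_step n p c i)\<^sup>*\<^sup>* x y"
      using x(4) by simp
    then show ?thesis
      using A_I[OF x(1-3) _ y(4)] by blast
  qed
  have face0: "label x i = 0" if "x \<in> grid n p" "i < n" "x i = 0" for x i
  proof -
    have "x \<in> A i" "grid_near n 1 x x"
      using that by (auto simp: A_def grid_near_def)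
    then show ?thesis
      using that unfolding label_def N_def by auto
  qed
  have face1: "label x i = 1" if "x \<in> grid n p" "i < n" "x i = p" for x i
  proof -
    have False if "y \<in> A i" "grid_near n 1 x y" for y
    proof -
      have "p \<le> y i + 1"
        using that \<open>x i = p\<close> \<open>i < n\<close> by (force simp: grid_near_def)
      then show False
        using A_E[OF that(1)] none[of i _ y] p \<open>i < n\<close> by auto
    qed
    then show ?thesis
      unfolding label_def N_def by auto
  qed
  \<comment> \<open>Kuhn's combinatorial lemma: some unit cell sees both labels in every direction.\<close>
  obtain q where q: "\<forall>i<n. q i < p" and change: "\<forall>i<n. \<exists>r s.
      (\<forall>j<n. q j \<le> r j \<and> r j \<le> q j + 1) \<and> (\<forall>j<n. q j \<le> s j \<and> s j \<le> q j + 1) \<and> label r i \<noteq> label s i"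
    by (rule kuhn_lemma[of p n label])
      (use p face0 face1 in \<open>auto simp: grid_def label_def\<close>)
  have qg: "q \<in> grid n p"
    using q by (auto simp: grid_def less_imp_le)
  \<comment> \<open>The colour of the corner \<open>q\<close> singles out a direction in which the cell has both labels, with
    \<open>r\<close> next to \<open>A i\<close>. Then \<open>q\<close> is within distance 2 of \<open>A i\<close>, hence in \<open>A i\<close>, so that the whole
    cell is next to \<open>A i\<close>, contradicting the other label.\<close>
  define i where "i = c q"
  have i: "i < n"
    using col qg by (simp add: i_def)
  obtain r s where r: "\<forall>j<n. q j \<le> r j \<and> r j \<le> q j + 1" and s: "\<forall>j<n. q j \<le> s j \<and> s j \<le> q j + 1"
    and rN: "r \<in> N i" and sN: "s \<notin> N i"
  proof -
    obtain r s where rs: "\<forall>j<n. q j \<le> r j \<and> r j \<le> q j + 1" "\<forall>j<n. q j \<le> s j \<and> s j \<le> q j + 1"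
      "label r i \<noteq> label s i"
      using change i by blast
    show thesis
    proof (cases "r \<in> N i")
      case True
      then show thesis using rs that[of r s] by (auto simp: label_def split: if_splits)
    next
      case False
      then show thesis using rs that[of s r] by (auto simp: label_def split: if_splits)
    qed
  qed
  obtain a where a: "a \<in> A i" "grid_near n 1 r a"
    using rN by (auto simp: N_def)
  have "grid_near n 2 a q"
    unfolding grid_near_def
  proof (intro allI impI)
    fix j assume "j < n"
    then have "q j \<le> r j \<and> r j \<le> q j + 1" "r j \<le> a j + 1 \<and> a j \<le> r j + 1"
      using a(2) r unfolding grid_near_def by blast+
    then show "a j \<le> q j + 2 \<and> q j \<le> a j + 2"
      by linarith
  qed
  then have "q \<in> A i"
    using near_A i a qg by (simp add: i_def)
  moreover have "s \<in> grid n p"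
    using s q by (fastforce simp: grid_def)
  moreover have "grid_near n 1 s q"
    using s by (auto simp: grid_near_def)
  ultimately have "s \<in> N i"
    unfolding N_def by blast
  with sN show False ..
qed

section \<open>Coloured bricks in Euclidean space\<close>

text \<open>Euclidean \<open>m\<close>-space is covered by \<open>m + 1\<close> colours so that each colour class falls into small
  bricks at a positive distance from one another. Colour \<open>j\<close> uses the lattice of cubes of side \<open>\<rho>\<close>
  translated by \<open>j / (m + 1)\<close> of a cube along the diagonal, with a neighbourhood of the walls removed.\<close>

lemma coloured_bricks:
  fixes m :: nat and \<rho> :: real
  assumes "0 < \<rho>"
  obtains col :: "(nat \<Rightarrow> real) \<Rightarrow> nat" and brick :: "(nat \<Rightarrow> real) \<Rightarrow> nat \<Rightarrow> int" and \<delta> where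
    "0 < \<delta>"
    "\<And>w. col w \<le> m"
    "\<And>w w' k. k < m \<Longrightarrow> col w = col w' \<Longrightarrow> \<bar>w k - w' k\<bar> < \<delta> \<Longrightarrow> brick w k = brick w' k"
    "\<And>w w' k. k < m \<Longrightarrow> col w = col w' \<Longrightarrow> brick w k = brick w' k \<Longrightarrow> \<bar>w k - w' k\<bar> \<le> \<rho>"
proof -
  define M where "M = int m + 1"
  have M: "0 < M"
    by (simp add: M_def)
  \<comment> \<open>Cells of side \<open>\<rho> / M\<close>, addressed by \<open>a\<close>. Colour \<open>j\<close> is allowed at \<open>w\<close> if no
    \<open>a w k\<close> is congruent to \<open>j\<close> modulo \<open>M\<close>; a point has only \<open>m\<close> coordinates to exclude
    colours with, so one of the \<open>m + 1\<close> colours remains.\<close>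
  define a where "a w k = \<lfloor>w k * M / \<rho>\<rfloor>" for w :: "nat \<Rightarrow> real" and k
  have "\<exists>j\<le>m. \<forall>k<m. a w k mod M \<noteq> int j" for w
  proof (rule ccontr)
    assume "\<not> ?thesis"
    then have "int ` {..m} \<subseteq> (\<lambda>k. a w k mod M) ` {..<m}"
      by force
    then have "card (int ` {..m}) \<le> card {..<m}"
      by (meson card_image_le card_mono finite_imageI finite_lessThan le_trans)
    then show False
      by (simp add: card_image)
  qed
  then obtain col where col: "\<And>w. col w \<le> m" "\<And>w k. k < m \<Longrightarrow> a w k mod M \<noteq> int (col w)"
    by metis
  have notdvd: "(a w k - int (col w)) mod M \<noteq> 0" if "k < m" for w k
  proof
    assume "(a w k - int (col w)) mod M = 0"
    then have "a w k mod M = int (col w) mod M"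
      by (simp add: mod_eq_dvd_iff mod_eq_0_iff_dvd)
    also have "\<dots> = int (col w)"
      using col(1)[of w] by (simp add: M_def)
    finally show False
      using col(2)[OF that] by blast
  qed
  have mod_range: "1 \<le> z mod M \<and> z mod M < M" if "z mod M \<noteq> 0" for z
    using that pos_mod_sign[OF M, of z] pos_mod_bound[OF M, of z] by linarith
  \<comment> \<open>The forbidden residues are walls between the bricks of one colour: a step by 1 in \<open>a\<close> that changed
    the brick would have to land on a wall.\<close>
  define brick where "brick w k = (a w k - int (col w)) div M" for w k
  have div_step: "x div M = y div M" if "x \<le> y" "y \<le> x + 1" "y mod M \<noteq> 0" for x y
  proof (cases "x = y")
    case False
    then have "y = x + 1"
      using that by simp
    moreover have "y mod M \<ge> 1"
      using that M pos_mod_sign[of M y] by linarith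
    ultimately have "x = M * (y div M) + (y mod M - 1)"
      using mult_div_mod_eq[of M y] by linarith
    moreover have "0 \<le> y mod M - 1" "y mod M - 1 < M"
      using \<open>y mod M \<ge> 1\<close> pos_mod_bound[OF M, of y] by linarith+
    ultimately show ?thesis
      by (metis div_mult_self2 div_pos_pos_trivial M add.commute add.right_neutral less_irrefl)
  qed simp
  show thesis
  proof (rule that[of "\<rho> / M" col brick])
    show "0 < \<rho> / M"
      using assms M by simp
    show "col w \<le> m" for w
      by (rule col)
    fix w w' k assume k: "k < m" and c: "col w = col w'"
    show "brick w k = brick w' k" if "\<bar>w k - w' k\<bar> < \<rho> / M"
    proof -
      have "\<bar>w k * M / \<rho> - w' k * M / \<rho>\<bar> < 1"
      proof -
        have "\<bar>w k * M / \<rho> - w' k * M / \<rho>\<bar> = \<bar>w k - w' k\<bar> * (M / \<rho>)"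
          using assms M by (simp add: diff_divide_distrib[symmetric] left_diff_distrib[symmetric] abs_mult)
        also have "\<dots> < \<rho> / M * (M / \<rho>)"
          using that assms M by (intro mult_strict_right_mono) auto
        finally show ?thesis
          using assms M by simp
      qed
      then have "a w k \<le> a w' k + 1" "a w' k \<le> a w k + 1"
        unfolding a_def by linarith+
      then show ?thesis
        unfolding brick_def
        using div_step[OF _ _ notdvd[OF k], of "a w k - int (col w)" w']
          div_step[OF _ _ notdvd[OF k], of "a w' k - int (col w')" w] c
        by linarith
    qed
    show "\<bar>w k - w' k\<bar> \<le> \<rho>" if "brick w k = brick w' k"
    proof -
      have "a w k - int (col w) = M * brick w k + (a w k - int (col w)) mod M"
           "a w' k - int (col w) = M * brick w k + (a w' k - int (col w)) mod M"
        using that c unfolding brick_def by (metis mult_div_mod_eq)+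
      moreover have "1 \<le> (a w k - int (col w)) mod M" "(a w k - int (col w)) mod M < M"
        "1 \<le> (a w' k - int (col w)) mod M" "(a w' k - int (col w)) mod M < M"
        using mod_range[OF notdvd[OF k, of w]] mod_range[OF notdvd[OF k, of w']] by (simp_all add: c)
      ultimately have "\<bar>a w k - a w' k\<bar> \<le> M - 2"
        by linarith
      then have "\<bar>w k * M / \<rho> - w' k * M / \<rho>\<bar> \<le> M"
        unfolding a_def by linarith
      moreover have "\<bar>w k * M / \<rho> - w' k * M / \<rho>\<bar> = \<bar>w k - w' k\<bar> * M / \<rho>"
        using assms M by (simp add: diff_divide_distrib[symmetric] left_diff_distrib[symmetric] abs_mult)
      ultimately show ?thesis
        using assms M by (simp add: field_simps)
    qed
  qed
qed

section \<open>The lower bound\<close>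

lemma small_mesh:
  fixes \<alpha> :: "nat \<Rightarrow> real" and n :: nat
  assumes "\<And>i. i < n \<Longrightarrow> 0 < \<alpha> i" and "0 < (\<epsilon> :: real)"
  obtains p :: nat where "N \<le> p" "\<And>i. i < n \<Longrightarrow> (2 / real p) powr \<alpha> i \<le> \<epsilon>"
proof -
  have "\<forall>\<^sub>F p in sequentially. (2 / real p) powr \<alpha> i \<le> \<epsilon>" if "i < n" for i
  proof -
    have "(\<lambda>p. (2 / real p) powr \<alpha> i) \<longlonglongrightarrow> 0"
      using assms(1)[OF that]
      by (intro tendsto_zero_powrI[OF lim_const_over_n tendsto_const]) auto
    then have "\<forall>\<^sub>F p in sequentially. (2 / real p) powr \<alpha> i < \<epsilon>"
      using assms(2) by (rule order_tendstoD)
    then show ?thesis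
      by (rule eventually_mono) simp
  qed
  then have "\<forall>\<^sub>F p in sequentially. \<forall>i\<in>{..<n}. (2 / real p) powr \<alpha> i \<le> \<epsilon>"
    by (intro eventually_ball_finite) auto
  then have "\<forall>\<^sub>F p in sequentially. N \<le> p \<and> (\<forall>i\<in>{..<n}. (2 / real p) powr \<alpha> i \<le> \<epsilon>)"
    by (intro eventually_conj eventually_ge_at_top)
  then obtain p where "N \<le> p \<and> (\<forall>i\<in>{..<n}. (2 / real p) powr \<alpha> i \<le> \<epsilon>)"
    by (auto simp: eventually_sequentially)
  then show thesis
    using that by blast
qed

text \<open>Pull the coloured bricks back to a fine grid in the unit cube of the coordinates. Since \<open>m < n\<close>,
  these are at most \<open>n\<close> colours, so some colour \<open>i\<close> crosses the cube in direction \<open>i\<close>. The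
  crossing stays over one brick, and thus in a single \<open>r\<close>-component over a set of diameter \<open>r\<close>;
  lightness makes that component too short to cross.\<close>

lemma hoelder_coords_dim_le:
  assumes "hoelder_coords n \<alpha> C X u" and "Lipschitz_light X (euclidean_n m) f"
  shows "n \<le> m"
proof (rule ccontr)
  assume "\<not> n \<le> m"
  then have mn: "m < n"
    by simp
  have \<alpha>: "\<And>i. i < n \<Longrightarrow> 0 < \<alpha> i \<and> \<alpha> i \<le> 1" and C: "0 < C"
    and surj: "\<And>v. \<exists>x\<in>mspace X. \<forall>i<n. u x i = v i"
    and u1: "\<And>x y i. x \<in> mspace X \<Longrightarrow> y \<in> mspace X \<Longrightarrow> i < n \<Longrightarrow>
          \<bar>u x i - u y i\<bar> powr \<alpha> i \<le> C * mdist X x y"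
    and u2: "\<And>x y t. x \<in> mspace X \<Longrightarrow> y \<in> mspace X \<Longrightarrow> 0 \<le> t \<Longrightarrow>
        (\<And>i. i < n \<Longrightarrow> \<bar>u x i - u y i\<bar> powr \<alpha> i \<le> t) \<Longrightarrow> mdist X x y \<le> C * t"
    using assms(1) unfolding hoelder_coords_def by blast+
  obtain L where L: "0 < L"
    and lip: "\<And>x y. x \<in> mspace X \<Longrightarrow> y \<in> mspace X \<Longrightarrow> mdist (euclidean_n m) (f x) (f y) \<le> L * mdist X x y"
    and light: "\<And>r xs x y. r > 0 \<Longrightarrow> r_path X r xs \<Longrightarrow>
       (\<And>x y. x \<in> set xs \<Longrightarrow> y \<in> set xs \<Longrightarrow> mdist (euclidean_n m) (f x) (f y) \<le> r) \<Longrightarrow>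
       x \<in> set xs \<Longrightarrow> y \<in> set xs \<Longrightarrow> mdist X x y \<le> L * r"
    by (rule Lipschitz_lightD[OF assms(2)]) blast
  \<comment> \<open>So small that on a set of diameter \<open>L * r\<close> every coordinate varies by less than \<open>1/2\<close>:
    \<open>C * (L * r) = 1/4 < 1/2 \<le> (1/2) powr \<alpha> i\<close>, as \<open>\<alpha> i \<le> 1\<close>.\<close>
  define r where "r = 1 / (4 * C * L)"
  have r: "0 < r" "C * (L * r) = 1 / 4"
    using C L by (auto simp: r_def)
  define \<rho> where "\<rho> = r / (m + 1)"
  have \<rho>: "0 < \<rho>"
    using r by (simp add: \<rho>_def)
  obtain col :: "(nat \<Rightarrow> real) \<Rightarrow> nat" and brick :: "(nat \<Rightarrow> real) \<Rightarrow> nat \<Rightarrow> int" and \<delta> where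
    \<delta>: "0 < \<delta>" and col: "\<And>w. col w \<le> m"
    and near_brick: "\<And>w w' k. k < m \<Longrightarrow> col w = col w' \<Longrightarrow> \<bar>w k - w' k\<bar> < \<delta> \<Longrightarrow> brick w k = brick w' k"
    and brick_near: "\<And>w w' k. k < m \<Longrightarrow> col w = col w' \<Longrightarrow> brick w k = brick w' k \<Longrightarrow> \<bar>w k - w' k\<bar> \<le> \<rho>"
    by (rule coloured_bricks[OF \<rho>, of m]) blast
  \<comment> \<open>Neighbouring grid points have to be at distance at most \<open>r\<close> in \<open>X\<close>, and their images closer than
    the gap \<open>\<delta>\<close> between bricks.\<close>
  define \<epsilon> where "\<epsilon> = min (r / C) (\<delta> / (2 * L * C))"
  have \<epsilon>: "0 < \<epsilon>" "C * \<epsilon> \<le> r" "L * (C * \<epsilon>) < \<delta>"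
  proof -
    show "0 < \<epsilon>"
      using r C L \<delta> by (simp add: \<epsilon>_def)
    have "\<epsilon> \<le> r / C" "\<epsilon> \<le> \<delta> / (2 * L * C)"
      by (simp_all add: \<epsilon>_def)
    then have "C * \<epsilon> \<le> r" "2 * (L * (C * \<epsilon>)) \<le> \<delta>"
      using C L by (simp_all add: field_simps)
    then show "C * \<epsilon> \<le> r" "L * (C * \<epsilon>) < \<delta>"
      using \<delta> by linarith+
  qed
  obtain p where p: "10 \<le> p" and mesh: "\<And>i. i < n \<Longrightarrow> (2 / real p) powr \<alpha> i \<le> \<epsilon>"
    by (rule small_mesh[of n \<alpha> \<epsilon> 10]) (use \<alpha> \<epsilon> in auto)
  have "\<exists>x\<in>mspace X. \<forall>i<n. u x i = real (q i) / real p" for q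
    by (rule surj)
  then obtain G where G: "\<And>q. G q \<in> mspace X" "\<And>q i. i < n \<Longrightarrow> u (G q) i = real (q i) / real p"
    by metis
  have G_near: "mdist X (G x) (G y) \<le> C * \<epsilon>" if "grid_near n 2 x y" for x y
  proof (rule u2)
    fix i assume i: "i < n"
    have "\<bar>real (x i) - real (y i)\<bar> \<le> 2"
      using that i by (auto simp: grid_near_def)
    then have "\<bar>real (x i) / p - real (y i) / p\<bar> \<le> 2 / real p"
      by (simp add: diff_divide_distrib[symmetric] divide_right_mono)
    then have "\<bar>u (G x) i - u (G y) i\<bar> powr \<alpha> i \<le> (2 / real p) powr \<alpha> i"
      using \<alpha>[OF i] i by (intro powr_mono2) (auto simp: G)
    also have "\<dots> \<le> \<epsilon>"
      by (rule mesh[OF i])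
    finally show "\<bar>u (G x) i - u (G y) i\<bar> powr \<alpha> i \<le> \<epsilon>" .
  qed (use \<epsilon> G in auto)
  define c where "c x = col (f (G x))" for x
  obtain i x y where i: "i < n" "c x = i" and xy: "x i \<le> 2" "p \<le> y i + 1"
    and chain: "(colour_step n p c i)\<^sup>*\<^sup>* x y"
  proof (rule hex_crossing[of p n c])
    show "c x < n" for x
      using col[of "f (G x)"] mn by (simp add: c_def)
  qed (use p in auto)
  \<comment> \<open>The colour chain becomes an \<open>r\<close>-path that stays over a single brick.\<close>
  have "\<exists>xs. r_path X r xs \<and> xs \<noteq> [] \<and> G x \<in> set xs \<and> last xs = G y \<and>
      (\<forall>z\<in>set xs. col (f z) = i \<and> (\<forall>k<m. brick (f z) k = brick (f (G x)) k))"
    using chain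
  proof (induction rule: rtranclp_induct)
    case base
    show ?case
      using i G by (intro exI[of _ "[G x]"]) (auto simp: r_path_def c_def)
  next
    case (step y z)
    then obtain xs where xs: "r_path X r xs" "xs \<noteq> []" "G x \<in> set xs" "last xs = G y"
      and same: "\<And>w. w \<in> set xs \<Longrightarrow> col (f w) = i \<and> (\<forall>k<m. brick (f w) k = brick (f (G x)) k)"
      by blast
    have yz: "grid_near n 2 y z" "col (f (G z)) = i"
      using step by (auto simp: colour_step_def c_def)
    have Gy: "G y \<in> set xs"
      using xs(2,4) last_in_set by metis
    have near: "mdist X (G y) (G z) \<le> C * \<epsilon>"
      by (rule G_near[OF yz(1)])
    have "brick (f (G z)) k = brick (f (G x)) k" if k: "k < m" for k
    proof -
      have "\<bar>f (G y) k - f (G z) k\<bar> \<le> mdist (euclidean_n m) (f (G y)) (f (G z))"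
        using abs_le_L2_set[OF k, of "\<lambda>k. f (G y) k - f (G z) k"] by simp
      also have "\<dots> \<le> L * mdist X (G y) (G z)"
        using G by (intro lip) auto
      also have "\<dots> \<le> L * (C * \<epsilon>)"
        using near L by (intro mult_left_mono) auto
      also have "\<dots> < \<delta>"
        by (rule \<epsilon>)
      finally have "brick (f (G y)) k = brick (f (G z)) k"
        using near_brick[OF k] same[OF Gy] yz(2) by simp
      then show ?thesis
        using same[OF Gy] k by simp
    qed
    then have "col (f w) = i \<and> (\<forall>k<m. brick (f w) k = brick (f (G x)) k)"
      if "w \<in> set (xs @ [G z])" for w
      using that yz(2) same[of w] by (cases "w = G z") simp_all
    moreover have "r_path X r (xs @ [G z])"
      using xs near \<epsilon> G by (intro r_path_snoc) auto
    moreover have "xs @ [G z] \<noteq> []" "G x \<in> set (xs @ [G z])" "last (xs @ [G z]) = G z"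
      using xs(3) by simp_all
    ultimately show ?case
      by blast
  qed
  then obtain xs where xs: "r_path X r xs" "xs \<noteq> []" "G x \<in> set xs" "last xs = G y"
    and same: "\<And>w. w \<in> set xs \<Longrightarrow> col (f w) = i \<and> (\<forall>k<m. brick (f w) k = brick (f (G x)) k)"
    by blast
  have Gy: "G y \<in> set xs"
    using xs(2,4) last_in_set by metis
  have "mdist (euclidean_n m) (f v) (f w) \<le> r" if "v \<in> set xs" "w \<in> set xs" for v w
  proof -
    have "mdist (euclidean_n m) (f v) (f w) \<le> (\<Sum>k<m. \<bar>f v k - f w k\<bar>)"
      by (simp add: L2_set_le_sum_abs)
    also have "\<dots> \<le> (\<Sum>k<m. \<rho>)"
      using same[OF that(1)] same[OF that(2)] by (intro sum_mono brick_near) auto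
    also have "\<dots> \<le> r"
      using r by (simp add: \<rho>_def field_simps)
    finally show ?thesis .
  qed
  then have "mdist X (G x) (G y) \<le> L * r"
    using light[OF r(1) xs(1) _ xs(3) Gy] by blast
  then have "C * mdist X (G x) (G y) \<le> 1 / 4"
    using C r(2) by (metis mult_left_mono less_imp_le)
  then have small: "\<bar>real (x i) / p - real (y i) / p\<bar> powr \<alpha> i \<le> 1 / 4"
    using u1[OF G(1) G(1) i(1), of x y] i(1) by (simp add: G)
  have "real (x i) / p \<le> 1 / 5" "9 / 10 \<le> real (y i) / p"
    using xy p by (simp_all add: field_simps)
  then have "1 / 2 \<le> \<bar>real (x i) / p - real (y i) / p\<bar>"
    by linarith
  then have "(1 / 2) powr \<alpha> i \<le> \<bar>real (x i) / p - real (y i) / p\<bar> powr \<alpha> i"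
    using \<alpha>[OF i(1)] by (intro powr_mono2) auto
  moreover have "(1 / 2 :: real) powr 1 \<le> (1 / 2) powr \<alpha> i"
    using \<alpha>[OF i(1)] by (intro powr_mono') auto
  ultimately show False
    using small by simp
qed

section \<open>Lipschitz dimension of snowflakes and their products\<close>

lemma hoelder_coords_Lipschitz_dim:
  assumes "hoelder_coords n \<alpha> C X u"
  shows "Lipschitz_dim X = enat n"
proof (rule antisym)
  obtain f where "Lipschitz_light X (euclidean_n n) f"
    by (rule hoelder_coords_Lipschitz_light[OF assms])
  then show "Lipschitz_dim X \<le> enat n"
    unfolding Lipschitz_dim_def by (intro Inf_lower) blast
  show "enat n \<le> Lipschitz_dim X"
    unfolding Lipschitz_dim_def using hoelder_coords_dim_le[OF assms] by (intro Inf_greatest) auto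
qed

theorem corollary5p5:
  fixes n :: nat
  assumes "n \<ge> 1"
  shows "(\<forall>Y :: nat \<Rightarrow> 'a metric.
            (\<forall>i<n. snowflake_of (Y i) (euclidean_metric :: real metric)) \<longrightarrow>
            Lipschitz_dim (max_product_metric n Y) = enat n) \<and>
         (\<forall>Z :: 'b metric.
            snowflake_of Z (euclidean_n n) \<longrightarrow> Lipschitz_dim Z = enat n)"
proof (intro conjI allI impI)
  fix Y :: "nat \<Rightarrow> 'a metric"
  assume "\<forall>i<n. snowflake_of (Y i) (euclidean_metric :: real metric)"
  then show "Lipschitz_dim (max_product_metric n Y) = enat n"
    by (rule product_of_snowflakes_coords) (rule hoelder_coords_Lipschitz_dim)
next
  fix Z :: "'b metric"
  assume "snowflake_of Z (euclidean_n n)"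
  then show "Lipschitz_dim Z = enat n"
    by (rule snowflake_of_euclidean_coords) (rule hoelder_coords_Lipschitz_dim)
qed

end
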